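(* The $\Phi_t$-invariant measures $\nu_t$ on $D^2$, supported on the attractors $\Lambda_t$, vary weakly continuously with $t\in J$: if $t_i\to t_*$ in $J$ then $\int_{D^2}\alpha\,d\nu_{t_i}\to\int_{D^2}\alpha\,d\nu_{t_*}$ for all $\alpha\in C(D^2,\mathbb R)$.
   Context: Let $I=[-1,1]$, $J=(1,2]$, $f_t(x)=\min(t(x-1)+3,\,t(1-x)-1)$ the core tent map on $I$, and $\mu_t$ its unique absolutely continuous invariant probability measure. Inverse limits: $\varprojlim(X,g)=\{\langle x_0,x_1,\dots\rangle\in X^{\mathbb N}:g(x_{n+1})=x_n\}$ with product topology, projections $\pi_n$, natural extension $\hat g\langle x_0,x_1,\dots\rangle=\langle g(x_0),x_0,x_1,\dots\rangle$; a $g$-invariant probability $\nu$ induces the unique $\hat g$-invariant $\hat\nu$ with $(\pi_n)_*\hat\nu=\nu$ for all $n$. Disk setup: let $S$ be the circle of radius 2 with angular coordinate $y$, and $D$ the disk of radius 2, decomposed (as a smooth embedding of the mapping cylinder of $y\mapsto\cos y$) into arcs so that each point has coordinates $(y,s)\in S\times[0,1]$, with $(y,0)=y\in S$ and $(y,1)=\cos y\in I$ (so $I\subset D$). Let $\Upsilon(y,s)=(y,2s)$ for $s\le 1/2$ and $\Upsilon(y,s)=(y,1)$ for $s\ge1/2$. An unwrapping is a continuously varying family of orientation-preserving near-homeomorphisms $\bar f_t\colon D\to D$ ($t\in J$) such that $\bar f_t$ is injective on $I$ with $\bar f_t(I)\subset\{s\ge1/2\}$, $\Upsilon\circ\bar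 f_t|_I=f_t$, and the second coordinate of $\bar f_t(y,s)$ is $s$ for $s\in[0,1/2]$. Put $H_t=\Upsilon\circ\bar f_t$, $\hat D_t=\varprojlim(D,H_t)$, $\hat I_t=\varprojlim(I,f_t)\subset\hat D_t$, and $\hat\mu_t$ the $\hat f_t$-invariant measure induced by $\mu_t$. Let $\Pi=D\times J$, $H(z,t)=(H_t(z),t)$, $\widehat\Pi=\varprojlim(\Pi,H)$, and identify $\hat D_t$ with its image under $\langle z_0,z_1,\dots\rangle\mapsto\langle(z_0,t),(z_1,t),\dots\rangle$. Let $h\colon\widehat\Pi\to D^2$ be a continuous map (provided by a parameterized Brown theorem) whose restriction $h_t$ to each $\hat D_t$ is a homeomorphism onto the disk $D^2$. Define $\Phi_t=h_t\circ\hat H_t\circ h_t^{-1}$, $\Lambda_t=h_t(\hat I_t)$, and $\nu_t=(h_t)_*\hat\mu_t$. *)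

theory Defs
  imports "HOL-Probability.Probability" "HOL-Complex_Analysis.Complex_Analysis"
begin

text \<open>The plane is modelled by the type complex. I = [-1,1] sits in D as the real segment.\<close>

definition Iint :: "real set" where "Iint = {-1..1}"
definition Jint :: "real set" where "Jint = {1<..2}"

definition tent :: "real \<Rightarrow> real \<Rightarrow> real" where
  "tent t x = min (t * (x - 1) + 3) (t * (1 - x) - 1)"

text \<open>Disk coordinates: P y s is the point with coordinates (y,s). The conditions say
  that P induces an embedding of the mapping cylinder of y \<mapsto> cos y onto the disk of radius 2,
  with level s = 0 the circle of radius 2 (angular coordinate y) and level s = 1 the segment I.\<close>
definition disk_coords :: "(real \<Rightarrow> real \<Rightarrow> complex) \<Rightarrow> bool" where
  "disk_coords P \<longleftrightarrow>
     continuous_on (UNIV \<times> {0..1}) (\<lambda>(y,s). P y s)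
   \<and> (\<forall>y. P y 0 = 2 * cis y)
   \<and> (\<forall>y. P y 1 = complex_of_real (cos y))
   \<and> (\<lambda>(y,s). P y s) ` (UNIV \<times> {0..1}) = cball 0 2
   \<and> (\<forall>y s y' s'. s \<in> {0..1} \<longrightarrow> s' \<in> {0..1} \<longrightarrow>
        (P y s = P y' s' \<longleftrightarrow>
           s = s' \<and> (if s = 1 then cos y = cos y' else (\<exists>k::int. y' = y + 2 * pi * of_int k))))"

definition Upsilon :: "(real \<Rightarrow> real \<Rightarrow> complex) \<Rightarrow> complex \<Rightarrow> complex" where
  "Upsilon P z = (let (y, s) = (SOME (y, s). s \<in> {0..1} \<and> P y s = z) in P y (min (2 * s) 1))"

definition orient_pres_homeo :: "(complex \<Rightarrow> complex) \<Rightarrow> bool" where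
  "orient_pres_homeo g \<longleftrightarrow>
     (\<exists>g'. homeomorphism (cball 0 2) (cball 0 2) g g')
     \<and> winding_number (g \<circ> circlepath 0 2) (g 0) = 1"

definition orient_pres_near_homeo :: "(complex \<Rightarrow> complex) \<Rightarrow> bool" where
  "orient_pres_near_homeo F \<longleftrightarrow>
     F ` cball 0 2 \<subseteq> cball 0 2 \<and>
     (\<forall>e>0. \<exists>g. orient_pres_homeo g \<and> (\<forall>z\<in>cball 0 2. dist (g z) (F z) < e))"

definition unwrapping :: "(real \<Rightarrow> real \<Rightarrow> complex) \<Rightarrow> (real \<Rightarrow> complex \<Rightarrow> complex) \<Rightarrow> bool" where
  "unwrapping P fbar \<longleftrightarrow>
     continuous_on (Jint \<times> cball 0 2) (\<lambda>(t,z). fbar t z)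
   \<and> (\<forall>t\<in>Jint. orient_pres_near_homeo (fbar t)
        \<and> inj_on (fbar t) (complex_of_real ` Iint)
        \<and> (\<forall>x\<in>Iint. \<exists>y s. s \<in> {1/2..1} \<and> fbar t (complex_of_real x) = P y s)
        \<and> (\<forall>x\<in>Iint. Upsilon P (fbar t (complex_of_real x)) = complex_of_real (tent t x))
        \<and> (\<forall>y s. s \<in> {0..1/2} \<longrightarrow> (\<exists>y'. fbar t (P y s) = P y' s)))"

definition Hmap :: "(real \<Rightarrow> real \<Rightarrow> complex) \<Rightarrow> (real \<Rightarrow> complex \<Rightarrow> complex) \<Rightarrow> real \<Rightarrow> complex \<Rightarrow> complex" where
  "Hmap P fbar t = Upsilon P \<circ> fbar t"

text \<open>Inverse limits, as subsets of the product space nat \<Rightarrow> complex (product topology).\<close>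
definition Dhat :: "(real \<Rightarrow> real \<Rightarrow> complex) \<Rightarrow> (real \<Rightarrow> complex \<Rightarrow> complex) \<Rightarrow> real \<Rightarrow> (nat \<Rightarrow> complex) set" where
  "Dhat P fbar t = {x. \<forall>n. x n \<in> cball 0 2 \<and> Hmap P fbar t (x (Suc n)) = x n}"

definition Ihat :: "real \<Rightarrow> (nat \<Rightarrow> complex) set" where
  "Ihat t = {x. \<forall>n. x n \<in> complex_of_real ` Iint \<and>
                      complex_of_real (tent t (Re (x (Suc n)))) = x n}"

definition fhat :: "real \<Rightarrow> (nat \<Rightarrow> complex) \<Rightarrow> nat \<Rightarrow> complex" where
  "fhat t x = (\<lambda>n. case n of 0 \<Rightarrow> complex_of_real (tent t (Re (x 0))) | Suc m \<Rightarrow> x m)"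

definition is_acim :: "real \<Rightarrow> real measure \<Rightarrow> bool" where
  "is_acim t mu \<longleftrightarrow> prob_space mu \<and> sets mu = sets borel \<and> emeasure mu Iint = 1
     \<and> absolutely_continuous lborel mu \<and> distr mu borel (tent t) = mu"

definition is_induced_measure :: "real \<Rightarrow> real measure \<Rightarrow> (nat \<Rightarrow> complex) measure \<Rightarrow> bool" where
  "is_induced_measure t mu hmu \<longleftrightarrow> prob_space hmu \<and> sets hmu = sets borel
     \<and> (AE x in hmu. x \<in> Ihat t)
     \<and> distr hmu borel (fhat t) = hmu
     \<and> (\<forall>n. distr hmu borel (\<lambda>x. Re (x n)) = mu)"

definition nu_meas :: "(real \<Rightarrow> real \<Rightarrow> complex) \<Rightarrow> (real \<Rightarrow> complex \<Rightarrow> complex) \<Rightarrow>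
    (real \<Rightarrow> (nat \<Rightarrow> complex) \<Rightarrow> complex) \<Rightarrow> (real \<Rightarrow> (nat \<Rightarrow> complex) measure) \<Rightarrow> real \<Rightarrow> complex measure" where
  "nu_meas P fbar h hmu t =
     distr (restrict_space (hmu t) (Dhat P fbar t)) (restrict_space borel (cball 0 1)) (h t)"

end

theory Submission
  imports Defs
begin

text \<open>
  Write \<open>E\<^sub>a(g)\<close> for the integral of \<open>g\<close> over \<open>{a..1}\<close>. Pulling back by the tent map \<open>f\<close> gives
  \<open>E\<^sub>a(g \<circ> f) = (E\<^sub>-\<^sub>1(g) + \<sigma>(a) E\<^bsub>f(a)\<^esub>(g)) / t\<close>, where \<open>\<sigma>(a)\<close> is the sign of the slope at \<open>a\<close>; with
  \<open>g = 1\<close> the lengths \<open>1 - a\<close> obey the same relation. Hence the Birkhoff sums of \<open>g\<close> satisfy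
  \<open>E\<^sub>a(S\<^sub>N g) = (1 - a) / 2 \<cdot> E\<^sub>-\<^sub>1(S\<^sub>N g) + O(1)\<close> uniformly in \<open>a\<close>. Approximating a density by step functions
  then shows that every absolutely continuous invariant measure integrates \<open>g\<close> to the limit of
  \<open>E\<^sub>-\<^sub>1(S\<^sub>N g) / (2N)\<close>.

  The convergence is made uniform in \<open>t\<close> with the explicit invariant functional
  \<open>\<Psi>(g) = \<Sum>\<^sub>n e\<^sub>n t\<^bsup>-n\<^esup> E\<^bsub>a\<^sub>n\<^esub>(g)\<close>, where \<open>a\<^sub>n = f\<^sup>n(-1)\<close> and \<open>e\<^sub>n\<close> is the product of the signs \<open>\<sigma>(a\<^sub>k)\<close>,
  \<open>k < n\<close>. The error is \<open>O(1 / (N \<Psi>(1)))\<close>, and \<open>\<Psi>(1)\<close> is bounded away from \<open>0\<close> on compact subsets of \<open>(1, 2]\<close>: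
  by explicit estimates if \<open>t\<^sup>2 \<ge> 2\<close>, and by the renormalization identity \<open>\<Psi>\<^sub>t(1) = 2 (t - 1) / t \<cdot> \<Psi>\<^bsub>t\<^sup>2\<^esub>(1)\<close>
  below. For fixed \<open>N\<close> the average \<open>E\<^sub>-\<^sub>1(S\<^sub>N g) / (2N)\<close> is continuous in \<open>t\<close>, so the invariant measures vary
  weakly continuously. On the inverse limit, a continuous function is uniformly close to a function of a
  single far-out coordinate, because that coordinate determines all the earlier ones.
\<close>

section \<open>Tent maps and integrals over end intervals\<close>

text \<open>For \<open>1 < t\<close> this is where the two branches cross; \<open>tent t\<close>
  attains its maximum 1 there.\<close>

definition turn :: "real \<Rightarrow> real" where "turn t = 1 - 2 / t"

text \<open>The value \<open>0\<close> at the turning point keeps the renormalization identity valid when the orbit hits it.\<close>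

definition branch_sgn :: "real \<Rightarrow> real \<Rightarrow> real" where "branch_sgn t a = sgn (turn t - a)"

text \<open>The maximum 1 is sent to -1, so this is the orbit of the second image of the turning
  point.\<close>

definition orb :: "real \<Rightarrow> nat \<Rightarrow> real" where "orb t n = (tent t ^^ n) (-1)"

definition orb_sgn :: "real \<Rightarrow> nat \<Rightarrow> real" where "orb_sgn t n = (\<Prod>k<n. branch_sgn t (orb t k))"

definition tail_integral :: "(real \<Rightarrow> real) \<Rightarrow> real \<Rightarrow> real" where
  "tail_integral g a = integral {a..1} g"

definition orb_series :: "real \<Rightarrow> (nat \<Rightarrow> real) \<Rightarrow> real" where
  "orb_series t b = (\<Sum>n. orb_sgn t n / t ^ n * b n)"

text \<open>The value of the invariant functional at the constant 1, whose tail integral from a is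
  the length \<open>1 - a\<close>.\<close>

definition orb_mass :: "real \<Rightarrow> real" where "orb_mass t = orb_series t (\<lambda>n. 1 - orb t n)"

lemma turn_gt: "1 < t \<Longrightarrow> -1 < turn t"
  by (simp add: turn_def field_simps)

lemma turn_le: "1 < t \<Longrightarrow> t \<le> 2 \<Longrightarrow> turn t \<le> 0"
  by (simp add: turn_def field_simps)

lemma tent_left: "1 < t \<Longrightarrow> a \<le> turn t \<Longrightarrow> tent t a = t * (a - 1) + 3"
  by (simp add: tent_def turn_def field_simps min_def)

lemma tent_right: "1 < t \<Longrightarrow> turn t \<le> a \<Longrightarrow> tent t a = t * (1 - a) - 1"
  by (simp add: tent_def turn_def field_simps min_def)

lemma tent_mem_Iint:
  assumes t: "1 < t" "t \<le> 2" and a: "a \<in> Iint"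
  shows "tent t a \<in> Iint"
proof (cases "a \<le> turn t")
  case True
  have "t * 1 \<ge> t * (-a)" using a t by (intro mult_left_mono) (auto simp: Iint_def)
  moreover have "t * a \<le> t * turn t" using True t by (intro mult_left_mono) auto
  moreover have "t * turn t = t - 2" using t by (simp add: turn_def field_simps)
  ultimately show ?thesis using True t by (simp add: tent_left Iint_def algebra_simps)
next
  case False
  have "t * 1 \<ge> t * a" using a t by (intro mult_left_mono) (auto simp: Iint_def)
  moreover have "t * a \<ge> t * turn t" using False t by (intro mult_left_mono) auto
  moreover have "t * turn t = t - 2" using t by (simp add: turn_def field_simps)
  ultimately show ?thesis using False t by (simp add: tent_right Iint_def algebra_simps)
qed

lemma tent_iter_mem_Iint:
  assumes "1 < t" "t \<le> 2" "a \<in> Iint"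
  shows "(tent t ^^ n) a \<in> Iint"
  by (induction n) (use assms tent_mem_Iint in auto)

lemma orb_mem_Iint: "1 < t \<Longrightarrow> t \<le> 2 \<Longrightarrow> orb t n \<in> Iint"
  unfolding orb_def by (rule tent_iter_mem_Iint) (auto simp: Iint_def)

lemma orb_0 [simp]: "orb t 0 = -1"
  by (simp add: orb_def)

lemma orb_Suc: "orb t (Suc n) = tent t (orb t n)"
  by (simp add: orb_def)

lemma orb_sgn_0 [simp]: "orb_sgn t 0 = 1"
  by (simp add: orb_sgn_def)

lemma orb_sgn_Suc: "orb_sgn t (Suc n) = orb_sgn t n * branch_sgn t (orb t n)"
  by (simp add: orb_sgn_def)

lemma abs_branch_sgn_le: "\<bar>branch_sgn t a\<bar> \<le> 1"
  by (simp add: branch_sgn_def abs_sgn_eq)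

lemma abs_orb_sgn_le: "\<bar>orb_sgn t n\<bar> \<le> 1"
  unfolding orb_sgn_def abs_prod by (rule prod_le_1) (simp add: abs_branch_sgn_le)

text \<open>The case g = 1 of the pull-back relation for tail integrals. At the turning point the
  sign is 0 and \<open>1 - a\<close> is exactly \<open>2 / t\<close>.\<close>

lemma tent_conv_branch_sgn:
  assumes "1 < t"
  shows "1 - a = (2 + branch_sgn t a * (1 - tent t a)) / t"
proof (cases a "turn t" rule: linorder_cases)
  case less
  then show ?thesis using assms by (simp add: tent_left branch_sgn_def field_simps)
next
  case equal
  then show ?thesis using assms by (simp add: branch_sgn_def turn_def)
next
  case greater
  then show ?thesis using assms by (simp add: tent_right branch_sgn_def field_simps)
qed

lemma continuous_tent [continuous_intros]:
  assumes "continuous_on S f" "continuous_on S g"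
  shows "continuous_on S (\<lambda>x. tent (f x) (g x))"
  unfolding tent_def by (intro continuous_intros assms)

lemma continuous_tent_iter [continuous_intros]:
  assumes "continuous_on S f" "continuous_on S g"
  shows "continuous_on S (\<lambda>x. (tent (f x) ^^ n) (g x))"
  by (induction n) (auto intro!: continuous_intros assms)

lemma integral_comp_affine:
  fixes g :: "real \<Rightarrow> real"
  assumes g: "continuous_on UNIV g" and m: "m \<noteq> 0" and ab: "a \<le> b"
  shows "integral {a..b} (\<lambda>x. g (m * x + c)) =
     (if m > 0 then integral {m * a + c..m * b + c} g / m
      else - integral {m * b + c..m * a + c} g / m)"
proof (cases "m > 0")
  case True
  have "(g has_integral integral {m * a + c..m * b + c} g) (cbox (m * a + c) (m * b + c))"
    unfolding cbox_interval by (intro integrable_integral integrable_continuous_interval continuous_on_subset[OF g]) auto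
  from has_integral_affinity'[OF this, of m c] True
  have "((\<lambda>x. g (m * x + c)) has_integral integral {m * a + c..m * b + c} g / m) {a..b}"
    by (simp add: divide_simps)
  then show ?thesis using True by (simp add: integral_unique)
next
  case False
  have "(g has_integral integral {m * b + c..m * a + c} g) (cbox (m * b + c) (m * a + c))"
    unfolding cbox_interval by (intro integrable_integral integrable_continuous_interval continuous_on_subset[OF g]) auto
  \<comment> \<open>A negative slope is handled with the positive slope \<open>-m\<close> on the
    reflected interval, followed by a reflection back.\<close>
  from has_integral_affinity'[OF this, of "-m" c] False m
  have "((\<lambda>x. g (- m * x + c)) has_integral - integral {m * b + c..m * a + c} g / m) {-b..-a}"
    by (simp add: divide_simps)
  from has_integral_reflect_real[THEN iffD2, OF this]
  have "((\<lambda>x. g (m * x + c)) has_integral - integral {m * b + c..m * a + c} g / m) {a..b}"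
    by simp
  then show ?thesis using False by (simp add: integral_unique)
qed

text \<open>Substitution on each branch. The right branch maps the interval from the turning point
  to 1 onto \<open>Iint\<close>. If a lies left of the turning point, the left branch adds the
  integral over \<open>{tent t a..1}\<close>; if a lies right of it, the missing piece of the right
  branch removes that integral.\<close>

lemma tail_integral_tent:
  assumes t: "1 < t" "t \<le> 2" and a: "a \<in> Iint" and g: "continuous_on UNIV g"
  shows "tail_integral (\<lambda>x. g (tent t x)) a
    = (tail_integral g (-1) + branch_sgn t a * tail_integral g (tent t a)) / t"
proof -
  \<comment> \<open>Stated for every u at or beyond the turning point, so that it also supplies the
    right-branch part when a lies to the left.\<close>
  have right: "integral {u..1} (\<lambda>x. g (tent t x))
      = (tail_integral g (-1) - tail_integral g (tent t u)) / t" if u: "turn t \<le> u" "u \<le> 1" for u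
  proof -
    have "integral {u..1} (\<lambda>x. g (tent t x)) = integral {u..1} (\<lambda>x. g ((-t) * x + (t - 1)))"
      by (rule integral_cong) (use u t in \<open>auto simp: tent_right algebra_simps\<close>)
    also have "\<dots> = integral {-1..tent t u} g / t"
      using u t by (subst integral_comp_affine[OF g]) (auto simp: tent_right algebra_simps)
    also have "integral {-1..tent t u} g = tail_integral g (-1) - tail_integral g (tent t u)"
    proof -
      have "tent t u \<in> Iint" using u t turn_gt[of t] by (intro tent_mem_Iint) (auto simp: Iint_def)
      then show ?thesis unfolding tail_integral_def
        using Henstock_Kurzweil_Integration.integral_combine[of "-1" "tent t u" 1 g]
          integrable_continuous_interval[OF continuous_on_subset[OF g]] by (auto simp: Iint_def)
    qed
    finally show ?thesis .
  qed
  have turn1: "turn t \<le> 1" "tent t (turn t) = 1" using t by (auto simp: turn_def tent_def)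
  show ?thesis
  proof (cases a "turn t" rule: linorder_cases)
    case less
    have cont: "continuous_on S (\<lambda>x. g (tent t x))" for S
      by (rule continuous_on_compose2[OF g]) (auto intro!: continuous_intros)
    have "integral {a..turn t} (\<lambda>x. g (tent t x)) = integral {a..turn t} (\<lambda>x. g (t * x + (3 - t)))"
      by (rule integral_cong) (use t in \<open>auto simp: tent_left algebra_simps\<close>)
    also have "\<dots> = integral {t * a + (3 - t)..t * turn t + (3 - t)} g / t"
      using less t by (subst integral_comp_affine[OF g]) auto
    also have "\<dots> = tail_integral g (tent t a) / t"
      using less t by (simp add: tent_left tail_integral_def turn_def field_simps)
    finally have "integral {a..turn t} (\<lambda>x. g (tent t x)) = tail_integral g (tent t a) / t" .
    moreover have "integral {turn t..1} (\<lambda>x. g (tent t x)) = tail_integral g (-1) / t"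
      using right[of "turn t"] turn1 by (simp add: tail_integral_def)
    moreover have "tail_integral (\<lambda>x. g (tent t x)) a =
       integral {a..turn t} (\<lambda>x. g (tent t x)) + integral {turn t..1} (\<lambda>x. g (tent t x))"
      unfolding tail_integral_def using less turn1
      by (subst Henstock_Kurzweil_Integration.integral_combine) (auto intro!: integrable_continuous_interval cont)
    ultimately show ?thesis using less by (simp add: branch_sgn_def add_divide_distrib)
  next
    case equal
    then show ?thesis using right[of a] turn1 by (simp add: tail_integral_def branch_sgn_def)
  next
    case greater
    then show ?thesis using right[of a] a by (simp add: tail_integral_def branch_sgn_def Iint_def)
  qed
qed

lemma abs_tail_integral_le:
  assumes g: "continuous_on UNIV g" and B: "\<And>x. x \<in> Iint \<Longrightarrow> \<bar>g x\<bar> \<le> B" and a: "a \<in> Iint"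
  shows "\<bar>tail_integral g a\<bar> \<le> 2 * B"
proof -
  have "0 \<le> B" using B[of 0] by (auto simp: Iint_def)
  have "norm (integral {a..1} g) \<le> B * (1 - a)"
    by (rule integral_bound) (use a B in \<open>auto simp: Iint_def intro: continuous_on_subset[OF g]\<close>)
  also have "\<dots> \<le> B * 2" using \<open>0 \<le> B\<close> a by (intro mult_left_mono) (auto simp: Iint_def)
  finally show ?thesis by (simp add: tail_integral_def mult.commute)
qed

section \<open>Orbit series and Birkhoff sums\<close>

lemma abs_orb_term_le:
  assumes "1 < t" "\<bar>b\<bar> \<le> B"
  shows "\<bar>orb_sgn t n / t ^ n * b\<bar> \<le> B * (1 / t) ^ n"
proof -
  have "\<bar>orb_sgn t n\<bar> * \<bar>b\<bar> \<le> 1 * B"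
    by (rule mult_mono) (use assms abs_orb_sgn_le in auto)
  then show ?thesis
    using assms by (simp add: abs_mult power_divide divide_right_mono)
qed

lemma summable_orb_series:
  assumes "1 < t" "\<And>n. \<bar>b n\<bar> \<le> B"
  shows "summable (\<lambda>n. orb_sgn t n / t ^ n * b n)"
  by (rule summable_comparison_test'[of "\<lambda>n. B * (1 / t) ^ n" 0])
     (use assms abs_orb_term_le[OF assms(1)] in \<open>auto intro!: summable_mult summable_geometric\<close>)

text \<open>Comparison with a geometric series of ratio \<open>1 / t\<close>. The case
  \<open>k = 0\<close> bounds the whole series; \<open>k = 2\<close> and \<open>k = 4\<close> serve
  the lower bound for the mass.\<close>

lemma abs_orb_series_tail_le:
  assumes t: "1 < t" and b: "\<And>n. \<bar>b n\<bar> \<le> B"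
  shows "\<bar>orb_series t b - (\<Sum>n<k. orb_sgn t n / t ^ n * b n)\<bar> \<le> B * t / (t ^ k * (t - 1))"
proof -
  let ?u = "\<lambda>n. orb_sgn t n / t ^ n * b n"
  have su: "summable ?u" by (rule summable_orb_series[OF t b])
  have geo: "(\<lambda>n. B * (1 / t) ^ (n + k)) sums (B / t ^ k * (1 / (1 - 1 / t)))"
    using t by (simp add: power_add power_divide mult_ac)
      (use sums_mult[OF geometric_sums[of "1 / t"], of "B / t ^ k"] t in \<open>simp add: power_divide mult_ac\<close>)
  have "orb_series t b - (\<Sum>n<k. ?u n) = (\<Sum>n. ?u (n + k))"
    unfolding orb_series_def using suminf_split_initial_segment[OF su, of k] by simp
  also have "norm \<dots> \<le> (\<Sum>n. B * (1 / t) ^ (n + k))"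
    by (rule norm_suminf_le) (use abs_orb_term_le[OF t b] sums_summable[OF geo] in auto)
  also have "\<dots> = B * t / (t ^ k * (t - 1))"
    using sums_unique[OF geo] t by (simp add: field_simps)
  finally show ?thesis by simp
qed

lemma abs_orb_series_le:
  assumes "1 < t" "\<And>n. \<bar>b n\<bar> \<le> B"
  shows "\<bar>orb_series t b\<bar> \<le> B * t / (t - 1)"
  using abs_orb_series_tail_le[where k = 0, OF assms] by simp

text \<open>The weight \<open>orb_sgn t n / t ^ n\<close> absorbs the sign and the factor
  \<open>1 / t\<close> of the recursion, so the second summand becomes term \<open>Suc n\<close> of
  the series of b. Only the first term of b is lost, and c enters through the sum of the
  weights.\<close>

lemma orb_series_telescope:
  assumes t: "1 < t" and b: "\<And>n. \<bar>b n\<bar> \<le> B" and d: "\<And>n. \<bar>d n\<bar> \<le> B'"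
    and rec: "\<And>n. d n = (c + branch_sgn t (orb t n) * b (Suc n)) / t"
  shows "orb_series t d = orb_series t b - b 0 + c * (orb_series t (\<lambda>_. 1) / t)"
proof -
  let ?u = "\<lambda>b n. orb_sgn t n / t ^ n * b n"
  have sb: "summable (?u b)" and s1: "summable (?u (\<lambda>_. 1))"
    using summable_orb_series[OF t b] summable_orb_series[OF t, of "\<lambda>_. 1" 1] by auto
  have sb': "summable (\<lambda>n. ?u b (Suc n))"
    using sb by (subst summable_Suc_iff)
  have "?u d n = c / t * ?u (\<lambda>_. 1) n + ?u b (Suc n)" for n
    using t by (simp add: rec orb_sgn_Suc field_simps)
  then have "orb_series t d = (\<Sum>n. c / t * ?u (\<lambda>_. 1) n + ?u b (Suc n))"
    by (simp add: orb_series_def)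
  also have "\<dots> = c / t * orb_series t (\<lambda>_. 1) + (\<Sum>n. ?u b (Suc n))"
    unfolding orb_series_def suminf_mult[OF s1, symmetric]
    by (rule suminf_add[OF summable_mult[OF s1] sb', symmetric])
  also have "(\<Sum>n. ?u b (Suc n)) = orb_series t b - b 0"
    using suminf_split_head[OF sb] by (simp add: orb_series_def)
  finally show ?thesis by simp
qed

lemma orb_dist_bound: "1 < t \<Longrightarrow> t \<le> 2 \<Longrightarrow> \<bar>1 - orb t n\<bar> \<le> 2"
  using orb_mem_Iint[of t n] by (auto simp: Iint_def)

text \<open>The lengths \<open>1 - orb t n\<close> satisfy the telescoping recursion with b = d and
  c = 2. Their series cancels, and the initial length 2 equals \<open>2 / t\<close> times the sum of
  the weights.\<close>

lemma orb_series_1: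
  assumes t: "1 < t" "t \<le> 2"
  shows "orb_series t (\<lambda>_. 1) = t"
proof -
  have "orb_series t (\<lambda>n. 1 - orb t n)
      = orb_series t (\<lambda>n. 1 - orb t n) - (1 - orb t 0) + 2 * (orb_series t (\<lambda>_. 1) / t)"
    by (rule orb_series_telescope)
       (use t orb_dist_bound[OF t] in \<open>auto simp: orb_Suc intro: tent_conv_branch_sgn\<close>)
  then show ?thesis using t by (simp add: field_simps)
qed

text \<open>Integration against the sum of the indicators of \<open>{orb t n..1}\<close> with
  weights \<open>orb_sgn t n / t ^ n\<close>: a signed expansion of the invariant density, up to a
  factor.\<close>

definition orb_functional :: "real \<Rightarrow> (real \<Rightarrow> real) \<Rightarrow> real" where
  "orb_functional t g = orb_series t (\<lambda>n. tail_integral g (orb t n))"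

lemma continuous_comp_tent_iter:
  fixes g :: "real \<Rightarrow> real"
  assumes "continuous_on UNIV g"
  shows "continuous_on UNIV (\<lambda>x. g ((tent t ^^ n) x))"
  by (rule continuous_on_compose2[OF assms]) (auto intro!: continuous_intros)

text \<open>The two corrections left by telescoping cancel because the weights sum to t.\<close>

lemma orb_functional_invariant:
  assumes t: "1 < t" "t \<le> 2" and g: "continuous_on UNIV g" and B: "\<And>x. x \<in> Iint \<Longrightarrow> \<bar>g x\<bar> \<le> B"
  shows "orb_functional t (\<lambda>x. g (tent t x)) = orb_functional t g"
proof -
  have "orb_functional t (\<lambda>x. g (tent t x)) = orb_functional t g
      - tail_integral g (orb t 0) + tail_integral g (-1) * (orb_series t (\<lambda>_. 1) / t)"
    unfolding orb_functional_def
  proof (rule orb_series_telescope[where B = "2 * B" and B' = "2 * B"])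
    show "\<bar>tail_integral g (orb t n)\<bar> \<le> 2 * B" for n
      by (rule abs_tail_integral_le) (use t g B orb_mem_Iint in auto)
    show "\<bar>tail_integral (\<lambda>x. g (tent t x)) (orb t n)\<bar> \<le> 2 * B" for n
      by (rule abs_tail_integral_le)
         (use t B orb_mem_Iint tent_mem_Iint continuous_comp_tent_iter[OF g, of 1 t] in auto)
    show "tail_integral (\<lambda>x. g (tent t x)) (orb t n) =
         (tail_integral g (- 1) + branch_sgn t (orb t n) * tail_integral g (orb t (Suc n))) / t" for n
      using tail_integral_tent[OF t orb_mem_Iint[OF t] g] by (simp add: orb_Suc)
  qed (use t in auto)
  then show ?thesis using t by (simp add: orb_series_1)
qed

lemma orb_functional_iter:
  assumes t: "1 < t" "t \<le> 2" and g: "continuous_on UNIV g" and B: "\<And>x. x \<in> Iint \<Longrightarrow> \<bar>g x\<bar> \<le> B"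
  shows "orb_functional t (\<lambda>x. g ((tent t ^^ n) x)) = orb_functional t g"
proof (induction n)
  case (Suc n)
  have "orb_functional t (\<lambda>x. (\<lambda>x. g ((tent t ^^ n) x)) (tent t x)) = orb_functional t (\<lambda>x. g ((tent t ^^ n) x))"
    by (rule orb_functional_invariant[where B = B])
       (use t continuous_comp_tent_iter[OF g] B tent_iter_mem_Iint in auto)
  then show ?case using Suc by (simp add: funpow_Suc_right del: funpow.simps)
qed simp

definition birkhoff_tail :: "real \<Rightarrow> (real \<Rightarrow> real) \<Rightarrow> nat \<Rightarrow> real \<Rightarrow> real" where
  "birkhoff_tail t g N a = (\<Sum>n<N. tail_integral (\<lambda>x. g ((tent t ^^ n) x)) a)"

lemma abs_tail_integral_iter_le:
  assumes t: "1 < t" "t \<le> 2" and g: "continuous_on UNIV g" and B: "\<And>x. x \<in> Iint \<Longrightarrow> \<bar>g x\<bar> \<le> B"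
    and a: "a \<in> Iint"
  shows "\<bar>tail_integral (\<lambda>x. g ((tent t ^^ n) x)) a\<bar> \<le> 2 * B"
  by (rule abs_tail_integral_le) (use assms continuous_comp_tent_iter[OF g] tent_iter_mem_Iint in auto)

lemma abs_birkhoff_tail_le:
  assumes t: "1 < t" "t \<le> 2" and g: "continuous_on UNIV g" and B: "\<And>x. x \<in> Iint \<Longrightarrow> \<bar>g x\<bar> \<le> B"
    and a: "a \<in> Iint"
  shows "\<bar>birkhoff_tail t g N a\<bar> \<le> real N * (2 * B)"
proof -
  have "\<bar>birkhoff_tail t g N a\<bar> \<le> (\<Sum>n<N. \<bar>tail_integral (\<lambda>x. g ((tent t ^^ n) x)) a\<bar>)"
    unfolding birkhoff_tail_def by (rule sum_abs)
  also have "\<dots> \<le> of_nat (card {..<N}) * (2 * B)"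
    by (rule sum_bounded_above) (rule abs_tail_integral_iter_le[OF assms])
  finally show ?thesis by simp
qed

text \<open>The deviation D satisfies
  \<open>\<bar>D a\<bar> \<le> 4 * B + \<bar>D (tent t a)\<bar> / t\<close>. Iterating along the
  orbit of a sums a geometric series, so the bound does not depend on N.\<close>

lemma birkhoff_tail_proportional:
  assumes t: "1 < t" "t \<le> 2" and g: "continuous_on UNIV g" and B: "\<And>x. x \<in> Iint \<Longrightarrow> \<bar>g x\<bar> \<le> B"
    and a: "a \<in> Iint"
  shows "\<bar>birkhoff_tail t g N a - (1 - a) / 2 * birkhoff_tail t g N (-1)\<bar> \<le> 4 * B * t / (t - 1)"
proof -
  define D where "D a = birkhoff_tail t g N a - (1 - a) / 2 * birkhoff_tail t g N (-1)" for a
  have B0: "0 \<le> B" using B[of 0] by (auto simp: Iint_def)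
  have step: "\<bar>D a\<bar> \<le> 4 * B + \<bar>D (tent t a)\<bar> / t" if a: "a \<in> Iint" for a
  proof -
    let ?E = "\<lambda>n a. tail_integral (\<lambda>x. g ((tent t ^^ n) x)) a"
    have E: "?E (Suc n) a = (?E n (-1) + branch_sgn t a * ?E n (tent t a)) / t" for n
      using tail_integral_tent[OF t a continuous_comp_tent_iter[OF g]]
      by (simp add: funpow_Suc_right del: funpow.simps)
    define U where "U = (\<Sum>n<N. ?E (Suc n) a)"
    have U1: "U = (birkhoff_tail t g N (-1) + branch_sgn t a * birkhoff_tail t g N (tent t a)) / t"
      unfolding U_def E birkhoff_tail_def sum_distrib_left sum.distrib[symmetric] sum_divide_distrib ..
    \<comment> \<open>Composition with \<open>tent t\<close> shifts the Birkhoff sum by one index,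
      which changes only the two boundary terms.\<close>
    have "U = birkhoff_tail t g N a + ?E N a - ?E 0 a"
      using sum.lessThan_Suc[of "\<lambda>n. ?E n a" N] sum.lessThan_Suc_shift[of "\<lambda>n. ?E n a" N]
      unfolding birkhoff_tail_def U_def by linarith
    then have U2: "birkhoff_tail t g N a = U - ?E N a + ?E 0 a" by simp
    \<comment> \<open>Lengths and tails obey the same recursion, so the contributions of the whole
      interval cancel and only D at the image point remains.\<close>
    have "D a = ?E 0 a - ?E N a + branch_sgn t a * D (tent t a) / t"
      unfolding D_def U2 U1 tent_conv_branch_sgn[OF t(1), of a] using t by (simp add: field_simps)
    also have "\<bar>\<dots>\<bar> \<le> \<bar>?E 0 a\<bar> + \<bar>?E N a\<bar> + \<bar>branch_sgn t a * D (tent t a) / t\<bar>"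
      by linarith
    also have "\<bar>branch_sgn t a * D (tent t a) / t\<bar> \<le> \<bar>D (tent t a)\<bar> / t"
      using t abs_branch_sgn_le[of t a]
      by (simp add: abs_mult divide_right_mono mult_left_le_one_le)
    finally show ?thesis
      using abs_tail_integral_iter_le[OF t g B a, of 0] abs_tail_integral_iter_le[OF t g B a, of N] by simp
  qed
  \<comment> \<open>This a priori bound grows with N, but it enters only with the factor
    \<open>(1 / t) ^ k\<close> and vanishes as k tends to infinity.\<close>
  define M where "M = real N * (4 * B)"
  have bound: "\<bar>D a\<bar> \<le> M" if a: "a \<in> Iint" for a
  proof -
    have "\<bar>birkhoff_tail t g N a\<bar> \<le> real N * (2 * B)"
      by (rule abs_birkhoff_tail_le[OF t g B a])
    moreover have "\<bar>birkhoff_tail t g N (-1)\<bar> \<le> real N * (2 * B)"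
      by (rule abs_birkhoff_tail_le[OF t g B]) (auto simp: Iint_def)
    moreover have "\<bar>(1 - a) / 2 * birkhoff_tail t g N (-1)\<bar> \<le> 1 * \<bar>birkhoff_tail t g N (-1)\<bar>"
      unfolding abs_mult by (rule mult_right_mono) (use a in \<open>auto simp: Iint_def\<close>)
    ultimately show ?thesis unfolding D_def M_def by linarith
  qed
  have it: "\<bar>D a\<bar> \<le> 4 * B * t / (t - 1) + M * (1 / t) ^ k" if "a \<in> Iint" for a k
    using that
  proof (induction k arbitrary: a)
    case 0
    have "0 \<le> 4 * B * t / (t - 1)" using B0 t by simp
    then show ?case using bound[OF 0] by simp
  next
    case (Suc k)
    have "\<bar>D a\<bar> \<le> 4 * B + \<bar>D (tent t a)\<bar> / t" by (rule step[OF Suc.prems])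
    also have "\<dots> \<le> 4 * B + (4 * B * t / (t - 1) + M * (1 / t) ^ k) / t"
      using Suc.IH[OF tent_mem_Iint[OF t Suc.prems]] t by (simp add: divide_right_mono)
    also have "\<dots> = 4 * B * t / (t - 1) + M * (1 / t) ^ Suc k"
    proof -
      have "4 * B + (4 * B * t / (t - 1)) / t = 4 * B * t / (t - 1)"
        using t by (simp add: field_simps)
      then show ?thesis by (simp add: add_divide_distrib)
    qed
    finally show ?case .
  qed
  have "(\<lambda>k. 4 * B * t / (t - 1) + M * (1 / t) ^ k) \<longlonglongrightarrow> 4 * B * t / (t - 1) + M * 0"
    using t by (intro tendsto_intros LIMSEQ_power_zero) auto
  then have "\<bar>D a\<bar> \<le> 4 * B * t / (t - 1) + M * 0"
    by (rule LIMSEQ_le_const) (use it[OF a] in auto)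
  then show ?thesis by (simp add: D_def)
qed

lemma orb_series_diff:
  assumes t: "1 < t" and b: "\<And>n. \<bar>b n\<bar> \<le> B" and d: "\<And>n. \<bar>d n\<bar> \<le> B'"
  shows "orb_series t (\<lambda>n. b n - d n * c) = orb_series t b - orb_series t d * c"
proof -
  let ?u = "\<lambda>b n. orb_sgn t n / t ^ n * b n"
  have sb: "summable (?u b)" and sd: "summable (?u d)"
    by (rule summable_orb_series[OF t b], rule summable_orb_series[OF t d])
  have "orb_series t (\<lambda>n. b n - d n * c) = (\<Sum>n. ?u b n - ?u d n * c)"
    unfolding orb_series_def by (rule suminf_cong) (simp only: right_diff_distrib mult.assoc)
  then show ?thesis
    unfolding orb_series_def suminf_mult2[OF sd] by (simp only: suminf_diff[OF sb summable_mult2[OF sd]])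
qed

text \<open>By invariance N times the functional of g is the functional of the N-th Birkhoff sum,
  whose tails are nearly proportional to lengths. One factor \<open>t / (t - 1)\<close> comes from
  that proportionality, the other from summing the errors over the orbit.\<close>

lemma orb_functional_conv_birkhoff:
  assumes t: "1 < t" "t \<le> 2" and g: "continuous_on UNIV g" and B: "\<And>x. x \<in> Iint \<Longrightarrow> \<bar>g x\<bar> \<le> B"
  shows "\<bar>real N * orb_functional t g - orb_mass t * birkhoff_tail t g N (-1) / 2\<bar> \<le> 4 * B * (t / (t - 1))\<^sup>2"
proof -
  define T where "T = birkhoff_tail t g N (-1)"
  have "real N * orb_functional t g = (\<Sum>n<N. orb_functional t (\<lambda>x. g ((tent t ^^ n) x)))"
    using orb_functional_iter[OF t g B] by simp
  also have "\<dots> = orb_series t (\<lambda>k. birkhoff_tail t g N (orb t k))"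
    unfolding orb_functional_def birkhoff_tail_def orb_series_def sum_distrib_left
    by (rule suminf_sum[symmetric], rule summable_orb_series[OF t(1)],
        rule abs_tail_integral_iter_le[OF t g B orb_mem_Iint[OF t]])
  finally have "real N * orb_functional t g - orb_mass t * (T / 2)
      = orb_series t (\<lambda>k. birkhoff_tail t g N (orb t k) - (1 - orb t k) * (T / 2))"
    unfolding orb_mass_def
    by (subst orb_series_diff[OF t(1) abs_birkhoff_tail_le[OF t g B orb_mem_Iint[OF t]] orb_dist_bound[OF t]]) auto
  also have "\<bar>\<dots>\<bar> \<le> 4 * B * t / (t - 1) * t / (t - 1)"
    by (rule abs_orb_series_le[OF t(1)])
       (use birkhoff_tail_proportional[OF t g B orb_mem_Iint[OF t], of N] in \<open>simp add: T_def mult_ac\<close>)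
  finally show ?thesis by (simp add: T_def power2_eq_square mult_ac)
qed

section \<open>Lower bound for the mass of the invariant functional\<close>

text \<open>Two terms of the series suffice if \<open>orb t 1\<close> is at or left of the turning
  point, and four otherwise; the rest is bounded geometrically.\<close>

lemma orb_mass_ge:
  assumes t: "1 < t" "t \<le> 2" and t2: "2 \<le> t\<^sup>2"
  shows "1 / 4 \<le> orb_mass t"
proof -
  \<comment> \<open>A rational bound just below the square root of 2.\<close>
  have t14: "7 / 5 \<le> t"
  proof (rule ccontr)
    assume "\<not> 7 / 5 \<le> t"
    then have "t\<^sup>2 \<le> (7 / 5)\<^sup>2" using t by (intro power_mono) auto
    then show False using t2 by (simp add: power2_eq_square)
  qed
  have o1: "orb t (Suc 0) = 3 - 2 * t" using t turn_gt[of t] by (simp add: orb_Suc tent_left)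
  have e1: "orb_sgn t (Suc 0) = 1" using t turn_gt[of t] by (simp add: orb_sgn_Suc branch_sgn_def)
  have tail: "\<bar>orb_mass t - (\<Sum>n<k. orb_sgn t n / t ^ n * (1 - orb t n))\<bar> \<le> 2 * t / (t ^ k * (t - 1))" for k
    unfolding orb_mass_def by (rule abs_orb_series_tail_le) (use t orb_dist_bound in auto)
  show ?thesis
  proof (cases "orb t (Suc 0) \<le> turn t")
    case True
    \<comment> \<open>This is exactly the case assumption \<open>3 - 2 * t \<le> 1 - 2 / t\<close>,
      cleared of denominators.\<close>
    have "1 \<le> t * (t - 1)" using True t by (simp add: o1 turn_def field_simps)
    have "2 * t / (t ^ 2 * (t - 1)) = 2 / (t * (t - 1))" using t by (simp add: power2_eq_square)
    also have "\<dots> \<le> 2" using \<open>1 \<le> t * (t - 1)\<close> by (simp add: divide_le_eq)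
    finally have "orb_mass t \<ge> (\<Sum>n<2. orb_sgn t n / t ^ n * (1 - orb t n)) - 2"
      using tail[of 2] by linarith
    also have "(\<Sum>n<2. orb_sgn t n / t ^ n * (1 - orb t n)) = 4 - 2 / t"
      using t by (simp add: numeral_2_eq_2 o1 e1 field_simps)
    finally have "orb_mass t \<ge> 2 - 2 / t" by simp
    moreover have "2 / t \<le> 2 / (7 / 5)" using t14 by (intro divide_left_mono) auto
    ultimately show ?thesis by simp
  next
    case False
    have e2: "orb_sgn t (Suc (Suc 0)) = -1"
      using False by (simp add: orb_sgn_Suc[of t "Suc 0"] e1 branch_sgn_def)
    have o2: "orb t (Suc (Suc 0)) = 2 * t\<^sup>2 - 2 * t - 1"
      using False t by (simp add: orb_Suc[of t "Suc 0"] tent_right o1 power2_eq_square algebra_simps)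
    have "(7 / 5) * (2 / 5) \<le> t * (t - 1)" using t14 by (intro mult_mono) auto
    then have tt: "14 / 25 \<le> t * (t - 1)" by simp
    \<comment> \<open>The turning point is at most 0, so positivity places this orbit point on the
      right branch and makes the next sign +1.\<close>
    have "0 < orb t (Suc (Suc 0))" using tt by (simp add: o2 power2_eq_square algebra_simps)
    then have e3: "orb_sgn t (Suc (Suc (Suc 0))) = 1"
      using turn_le[OF t] by (simp add: orb_sgn_Suc[of t "Suc (Suc 0)"] e2 branch_sgn_def)
    have "2 * (14 / 25) \<le> t\<^sup>2 * (t * (t - 1))" by (rule mult_mono) (use t2 tt in auto)
    have "2 * t / (t ^ 4 * (t - 1)) = 2 / (t\<^sup>2 * (t * (t - 1)))" using t by (simp add: power2_eq_square power4_eq_xxxx)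
    also have "\<dots> \<le> 2 / (2 * (14 / 25))" using \<open>2 * (14 / 25) \<le> _\<close> by (intro divide_left_mono) auto
    finally have "2 * t / (t ^ 4 * (t - 1)) \<le> 25 / 14" by simp
    from order_trans[OF tail this]
    have "orb_mass t \<ge> (\<Sum>n<4. orb_sgn t n / t ^ n * (1 - orb t n)) - 25 / 14"
      by linarith
    moreover have "(\<Sum>n<4. orb_sgn t n / t ^ n * (1 - orb t n))
        = 6 - 4 / t - 2 / t\<^sup>2 + (1 - orb t (Suc (Suc (Suc 0)))) / t ^ 3"
    proof -
      have "(\<Sum>n<4. orb_sgn t n / t ^ n * (1 - orb t n))
        = 2 + (2 * t - 2) / t - (2 + 2 * t - 2 * t\<^sup>2) / t\<^sup>2 + (1 - orb t (Suc (Suc (Suc 0)))) / t ^ 3"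
        by (simp add: eval_nat_numeral o1 e1 o2 e2 e3 minus_divide_left)
      also have "2 + (2 * t - 2) / t - (2 + 2 * t - 2 * t\<^sup>2) / t\<^sup>2 = 6 - 4 / t - 2 / t\<^sup>2"
        using t by (simp add: field_simps power2_eq_square)
      finally show ?thesis .
    qed
    \<comment> \<open>The fourth term is dropped as nonnegative. What remains is at least
      \<open>6 - 20/7 - 1 - 25/14 = 5/14\<close>.\<close>
    moreover have "0 \<le> (1 - orb t (Suc (Suc (Suc 0)))) / t ^ 3"
      using orb_mem_Iint[OF t, of "Suc (Suc (Suc 0))"] t by (simp add: Iint_def)
    moreover have "4 / t \<le> 4 / (7 / 5)" using t14 by (intro divide_left_mono) auto
    moreover have "2 / t\<^sup>2 \<le> 2 / 2" using t2 by (intro divide_left_mono) auto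
    ultimately show ?thesis by simp
  qed
qed

text \<open>The map sending b to x is affine, fixes 1 and takes -1 to \<open>3 - 2 * t\<close>. For
  \<open>t\<^sup>2 \<le> 2\<close> its image lies right of the turning point, and it conjugates
  \<open>tent (t\<^sup>2)\<close> to the second iterate of \<open>tent t\<close>. The first of the
  two steps reverses orientation, hence the opposite sign at \<open>tent t x\<close>.\<close>

lemma tent_renormalization:
  fixes t b :: real
  defines "x \<equiv> 1 - (t - 1) * (1 - b)"
  assumes t: "1 < t" "t\<^sup>2 \<le> 2" and b: "b \<in> Iint"
  shows "branch_sgn t x = -1" "tent t x = t * (1 - x) - 1"
    and "branch_sgn t (tent t x) = - branch_sgn (t\<^sup>2) b"
    and "1 - tent t (tent t x) = (t - 1) * (1 - tent (t\<^sup>2) b)"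
proof -
  have s: "1 < t\<^sup>2" using t by (simp add: one_less_power)
  have "(t - 1) * (1 - b) \<le> (t - 1) * 2" using t b by (intro mult_left_mono) (auto simp: Iint_def)
  moreover have "(t - 1) * 2 < 2 / t" using t by (simp add: field_simps power2_eq_square)
  ultimately have xt: "turn t < x" by (simp add: x_def turn_def)
  then show "branch_sgn t x = -1" by (simp add: branch_sgn_def)
  show y: "tent t x = t * (1 - x) - 1" using xt t by (simp add: tent_right)
  \<comment> \<open>The second step thus uses the left branch exactly when b is on the right branch
    of \<open>tent (t\<^sup>2)\<close>, and conversely.\<close>
  have *: "turn t - tent t x = (t * (t - 1)) * - (turn (t\<^sup>2) - b)"
    unfolding y unfolding x_def turn_def using t by (simp add: field_simps power2_eq_square)
  show sg: "branch_sgn t (tent t x) = - branch_sgn (t\<^sup>2) b"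
    unfolding branch_sgn_def * sgn_mult sgn_minus using t by simp
  have pos: "0 < t * (t - 1)" using t by simp
  show "1 - tent t (tent t x) = (t - 1) * (1 - tent (t\<^sup>2) b)"
  proof (cases "b \<le> turn (t\<^sup>2)")
    case True
    then have "(t * (t - 1)) * - (turn (t\<^sup>2) - b) \<le> 0" using pos by (simp add: mult_nonneg_nonpos)
    then have "turn t \<le> tent t x" using * by linarith
    then have e: "tent t (tent t x) = t * (1 - tent t x) - 1" by (rule tent_right[OF t(1)])
    show ?thesis unfolding e tent_left[OF s True] unfolding y unfolding x_def
      by (simp add: power2_eq_square algebra_simps)
  next
    case False
    then have "0 \<le> (t * (t - 1)) * - (turn (t\<^sup>2) - b)" using pos by simp
    then have "tent t x \<le> turn t" using * by linarith
    then have e: "tent t (tent t x) = t * (tent t x - 1) + 3" by (rule tent_left[OF t(1)])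
    have "turn (t\<^sup>2) \<le> b" using False by simp
    show ?thesis unfolding e tent_right[OF s \<open>turn (t\<^sup>2) \<le> b\<close>] unfolding y unfolding x_def
      by (simp add: power2_eq_square algebra_simps)
  qed
qed

text \<open>From index 1 on, the odd orbit points for t are affine copies of the orbit for
  \<open>t\<^sup>2\<close> with the same signs, and the even ones are their images with opposite
  signs. Each odd-even pair of terms is a weight for \<open>t\<^sup>2\<close> times an affine
  function of a length for \<open>t\<^sup>2\<close>.\<close>

lemma orb_mass_renormalization:
  assumes t: "1 < t" "t\<^sup>2 \<le> 2"
  shows "orb_mass t = 2 * (t - 1) / t * orb_mass (t\<^sup>2)"
proof -
  have s: "1 < t\<^sup>2" using t by (simp add: one_less_power)
  have "t \<le> t\<^sup>2" using t by (simp add: power2_eq_square)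
  then have t2: "t \<le> 2" using t by simp
  have odd: "1 - orb t (Suc (2 * n)) = (t - 1) * (1 - orb (t\<^sup>2) n) \<and> orb_sgn t (Suc (2 * n)) = orb_sgn (t\<^sup>2) n" for n
  proof (induction n)
    case 0
    then show ?case using t t2 turn_gt[of t] by (simp add: orb_Suc tent_left orb_sgn_Suc branch_sgn_def)
  next
    case (Suc n)
    note R = tent_renormalization[OF t orb_mem_Iint[OF s t(2), of n]]
    have x: "orb t (Suc (2 * n)) = 1 - (t - 1) * (1 - orb (t\<^sup>2) n)" using Suc by linarith
    have y: "orb t (Suc (Suc (2 * n))) = tent t (1 - (t - 1) * (1 - orb (t\<^sup>2) n))"
      by (simp add: orb_Suc[of t "Suc (2 * n)"] x)
    show ?case
      using R Suc by (simp add: orb_Suc[of t "Suc (Suc (2 * n))"] y orb_Suc[of "t\<^sup>2"]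
        orb_sgn_Suc[of t "Suc (Suc (2 * n))"] orb_sgn_Suc[of t "Suc (2 * n)"] x orb_sgn_Suc[of "t\<^sup>2"])
  qed
  have even: "orb t (Suc (Suc (2 * n))) = t * (t - 1) * (1 - orb (t\<^sup>2) n) - 1
      \<and> orb_sgn t (Suc (Suc (2 * n))) = - orb_sgn (t\<^sup>2) n" for n
  proof -
    note R = tent_renormalization(1,2)[OF t orb_mem_Iint[OF s t(2), of n]]
    have x: "orb t (Suc (2 * n)) = 1 - (t - 1) * (1 - orb (t\<^sup>2) n)" using odd[of n] by linarith
    show ?thesis using R odd[of n] unfolding orb_Suc[of t "Suc (2 * n)"] orb_sgn_Suc[of t "Suc (2 * n)"] x by simp
  qed
  let ?u = "\<lambda>n. orb_sgn t n / t ^ n * (1 - orb t n)"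
  have sum: "summable ?u" by (rule summable_orb_series[OF t(1) orb_dist_bound[OF t(1) t2]])
  \<comment> \<open>The initial term is 2; splitting it off makes the pairs start at odd
    indices.\<close>
  then have "(\<lambda>n. ?u (Suc n)) sums (orb_mass t - 2)"
    unfolding orb_mass_def orb_series_def using summable_sums[OF sum] by (subst sums_Suc_iff) simp
  from sums_group[OF this, of 2]
  have "(\<lambda>n. ?u (Suc (2 * n)) + ?u (Suc (Suc (2 * n)))) sums (orb_mass t - 2)"
    by (simp add: mult.commute numeral_2_eq_2)
  moreover have "?u (Suc (2 * n)) + ?u (Suc (Suc (2 * n))) =
      orb_sgn (t\<^sup>2) n / (t\<^sup>2) ^ n * (- (2 / t\<^sup>2) - (1 - orb (t\<^sup>2) n) * (- (2 * (t - 1) / t)))" for n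
  proof -
    let ?e = "orb_sgn (t\<^sup>2) n" and ?d = "1 - orb (t\<^sup>2) n"
    have p: "t ^ Suc (2 * n) = t * (t\<^sup>2) ^ n" "t ^ Suc (Suc (2 * n)) = t\<^sup>2 * (t\<^sup>2) ^ n"
      by (simp_all add: power_mult power2_eq_square)
    have o: "orb_sgn t (Suc (2 * n)) = ?e" "1 - orb t (Suc (2 * n)) = (t - 1) * ?d"
        "orb_sgn t (Suc (Suc (2 * n))) = - ?e" "1 - orb t (Suc (Suc (2 * n))) = 2 - t * (t - 1) * ?d"
      using odd[of n] even[of n] by simp_all
    have "?u (Suc (2 * n)) + ?u (Suc (Suc (2 * n)))
      = ?e / (t * (t\<^sup>2) ^ n) * ((t - 1) * ?d) + (- ?e) / (t\<^sup>2 * (t\<^sup>2) ^ n) * (2 - t * (t - 1) * ?d)"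
      unfolding p o ..
    also have "\<dots> = ?e / (t\<^sup>2) ^ n * (((t - 1) * ?d) / t - (2 - t * (t - 1) * ?d) / t\<^sup>2)"
    proof -
      have "e / (c * p) * y + (- e) / (d * p) * z = e / p * (y / c - z / d)" for c d e p y z :: real
        by (simp add: right_diff_distrib mult.commute)
      then show ?thesis .
    qed
    also have "((t - 1) * ?d) / t - (2 - t * (t - 1) * ?d) / t\<^sup>2 = - (2 / t\<^sup>2) - ?d * (- (2 * (t - 1) / t))"
      using t by (simp add: field_simps power2_eq_square)
    finally show ?thesis .
  qed
  ultimately have "orb_mass t - 2 = orb_series (t\<^sup>2) (\<lambda>n. - (2 / t\<^sup>2) - (1 - orb (t\<^sup>2) n) * (- (2 * (t - 1) / t)))"
    by (simp add: orb_series_def sums_iff)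
  also have "\<dots> = orb_series (t\<^sup>2) (\<lambda>n. - (2 / t\<^sup>2)) - orb_mass (t\<^sup>2) * (- (2 * (t - 1) / t))"
    unfolding orb_mass_def by (rule orb_series_diff[OF s _ orb_dist_bound[OF s t(2)], where B = "2 / t\<^sup>2"]) simp
  \<comment> \<open>The weights for \<open>t\<^sup>2\<close> sum to \<open>t\<^sup>2\<close>, so the
    constant part is -2 and cancels the initial term.\<close>
  also have "orb_series (t\<^sup>2) (\<lambda>n. - (2 / t\<^sup>2)) = -2"
    using orb_series_diff[OF s, of "\<lambda>_. 0" 0 "\<lambda>_. 1" 1 "2 / t\<^sup>2"] s t
    by (simp add: orb_series_1[OF s t(2)]) (simp add: orb_series_def)
  finally show ?thesis by simp
qed

text \<open>Induction on the number of squarings that bring t into the range of the explicit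
  estimate. Each renormalization costs at most a factor \<open>\<tau> - 1\<close>, and the number of
  squarings is bounded in terms of \<open>\<tau>\<close>.\<close>

lemma orb_mass_lower_bound:
  assumes \<tau>: "1 < \<tau>"
  obtains \<delta> where "\<delta> > 0" "\<And>t. \<tau> \<le> t \<Longrightarrow> t \<le> 2 \<Longrightarrow> \<delta> \<le> orb_mass t"
proof -
  have ind: "\<exists>\<delta>>0. \<forall>t. \<tau> \<le> t \<longrightarrow> t \<le> 2 \<longrightarrow> 2 \<le> t ^ (2 ^ Suc k) \<longrightarrow> \<delta> \<le> orb_mass t" for k
  proof (induction k)
    case 0
    then show ?case using \<tau> orb_mass_ge by (intro exI[of _ "1 / 4"]) auto
  next
    case (Suc k)
    then obtain \<delta> where \<delta>: "\<delta> > 0" "\<And>t. \<tau> \<le> t \<Longrightarrow> t \<le> 2 \<Longrightarrow> 2 \<le> t ^ (2 ^ Suc k) \<Longrightarrow> \<delta> \<le> orb_mass t" by blast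
    have "min (1 / 4) ((\<tau> - 1) * \<delta>) \<le> orb_mass t" if t: "\<tau> \<le> t" "t \<le> 2" "2 \<le> t ^ (2 ^ Suc (Suc k))" for t
    proof (cases "2 \<le> t\<^sup>2")
      case True
      then show ?thesis using orb_mass_ge[of t] t \<tau> by simp
    next
      case False
      have "t \<le> t\<^sup>2" using t \<tau> by (simp add: power2_eq_square)
      have "\<delta> \<le> orb_mass (t\<^sup>2)"
        by (rule \<delta>(2)) (use False t \<open>t \<le> t\<^sup>2\<close> in \<open>auto simp flip: power_mult\<close>)
      moreover have "\<tau> - 1 \<le> 2 * (t - 1) / t"
      proof -
        have "(\<tau> - 1) * t \<le> (t - 1) * 2" using t \<tau> by (intro mult_mono) auto
        then show ?thesis using t \<tau> by (simp add: field_simps)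
      qed
      ultimately have "(\<tau> - 1) * \<delta> \<le> 2 * (t - 1) / t * orb_mass (t\<^sup>2)"
        using \<delta> t \<tau> by (intro mult_mono) auto
      then show ?thesis using orb_mass_renormalization[of t] False t \<tau> by simp
    qed
    then show ?case using \<delta>(1) \<tau> by (intro exI[of _ "min (1 / 4) ((\<tau> - 1) * \<delta>)"]) auto
  qed
  \<comment> \<open>One n serves all \<open>t \<ge> \<tau>\<close>, because
    \<open>n \<le> 2 ^ Suc n\<close>.\<close>
  obtain n where n: "2 < \<tau> ^ n" using real_arch_pow[OF \<tau>] by blast
  obtain \<delta> where \<delta>: "\<delta> > 0" "\<And>t. \<tau> \<le> t \<Longrightarrow> t \<le> 2 \<Longrightarrow> 2 \<le> t ^ (2 ^ Suc n) \<Longrightarrow> \<delta> \<le> orb_mass t"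
    using ind[of n] by blast
  have "\<delta> \<le> orb_mass t" if t: "\<tau> \<le> t" "t \<le> 2" for t
  proof (rule \<delta>(2)[OF t])
    have "n \<le> 2 ^ Suc n" using less_exp[of "Suc n"] by linarith
    have "2 \<le> \<tau> ^ n" using n by simp
    also have "\<dots> \<le> t ^ n" using t \<tau> by (intro power_mono) auto
    also have "\<dots> \<le> t ^ (2 ^ Suc n)" using \<open>n \<le> _\<close> t \<tau> by (intro power_increasing) auto
    finally show "2 \<le> t ^ (2 ^ Suc n)" .
  qed
  with \<delta>(1) that show ?thesis by blast
qed

section \<open>Absolutely continuous invariant measures\<close>

text \<open>Passes from end intervals to densities. The rays form a generator of the Borel sets
  stable under intersection, and convergence to 0 survives complements and disjoint unions; hence it
  holds for indicators, simple functions and, since q is uniformly bounded, their limits in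
  L1.\<close>

lemma weak_null_integrable:
  fixes q :: "nat \<Rightarrow> real \<Rightarrow> real"
  assumes q_meas [measurable]: "\<And>N. q N \<in> borel_measurable borel"
    and q_le: "\<And>N x. \<bar>q N x\<bar> \<le> C * indicator {a..b} x"
    and ray: "\<And>c. (\<lambda>N. LINT x:{c..}|lborel. q N x) \<longlonglongrightarrow> 0"
    and r: "integrable lborel r"
  shows "(\<lambda>N. LINT x|lborel. r x * q N x) \<longlonglongrightarrow> 0"
proof -
  have C0: "0 \<le> C * indicator {a..b} x" for x using q_le[of 0 x] by linarith
  have q_0: "q N x = 0" if "x < a" for N x using q_le[of N x] that by simp
  have q_C: "\<bar>q N x\<bar> \<le> \<bar>C\<bar>" for N x
    by (rule order_trans[OF q_le]) (auto simp: indicator_def)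
  have int_dom: "set_integrable lborel A (\<lambda>x. C * indicator {a..b} x)" if "A \<in> sets borel" for A
    unfolding set_integrable_def by (rule integrable_mult_indicator) (use that in \<open>simp_all add: integrable_indicator_iff emeasure_lborel_Icc_eq\<close>)
  have int_q: "set_integrable lborel A (q N)" if "A \<in> sets borel" for A N
    using int_dom[OF that] unfolding set_integrable_def
    by (rule Bochner_Integration.integrable_bound)
       (use that q_le[of N] C0 in \<open>auto simp: indicator_def\<close>)
  have sets: "(\<lambda>N. LINT x:A|lborel. q N x) \<longlonglongrightarrow> 0" if "A \<in> sets borel" for A
  proof -
    have stable: "Int_stable (range (atLeast :: real \<Rightarrow> real set))"
    proof (unfold Int_stable_def, safe)
      fix c d :: real
      have "{c..} \<inter> {d..} = {max c d..}" by auto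
      then show "{c..} \<inter> {d..} \<in> range atLeast" by blast
    qed
    have gen: "sigma_sets UNIV (range (atLeast :: real \<Rightarrow> real set)) = sets borel"
      by (subst borel_Ici) (simp add: sets_measure_of)
    have sub: "range (atLeast :: real \<Rightarrow> real set) \<subseteq> Pow UNIV" by simp
    have "A \<in> sigma_sets UNIV (range atLeast)" using that by (simp add: gen)
    from stable sub this show ?thesis
    proof (induction A rule: sigma_sets_induct_disjoint)
      case (basic A)
      then show ?case using ray by auto
    next
      case empty
      show ?case by (simp add: set_lebesgue_integral_def)
    next
      case (compl A)
      have Ab: "A \<in> sets borel" using compl gen by simp
      \<comment> \<open>Since q vanishes left of a, the integral over the line is one over a ray, so
        the hypothesis on rays covers it.\<close>
      have U: "(LINT x:UNIV|lborel. q N x) = (LINT x:{a..}|lborel. q N x)" for N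
        unfolding set_lebesgue_integral_def
        by (intro Bochner_Integration.integral_cong) (auto simp: indicator_def q_0)
      have "(LINT x:UNIV - A|lborel. q N x) = (LINT x:{a..}|lborel. q N x) - (LINT x:A|lborel. q N x)" for N
        using set_integral_Un[of A "UNIV - A" lborel "q N"] int_q Ab U[of N] by auto
      then show ?case using tendsto_diff[OF ray compl(2), of a] by simp
    next
      case (union A)
      have Ab: "A i \<in> sets borel" for i using union gen by auto
      define M where "M i = (LINT x:A i|lborel. C * indicator {a..b} x)" for i
      \<comment> \<open>Limit and sum are interchanged by domination: \<open>M i\<close> is C times
        the measure of \<open>A i \<inter> {a..b}\<close>, summable by disjointness.\<close>
      have "(\<lambda>N. \<Sum>i. LINT x:A i|lborel. q N x) \<longlonglongrightarrow> (\<Sum>i. 0)"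
      proof (rule tannerys_theorem[where M = M, THEN conjunct2, THEN conjunct2])
        show "\<forall>\<^sub>F (k, n) in sequentially \<times>\<^sub>F sequentially. norm (LINT x:A k|lborel. q n x) \<le> M k"
        proof (intro always_eventually allI, clarify)
          fix k n
          have "norm (LINT x:A k|lborel. q n x) \<le> (LINT x:A k|lborel. norm (q n x))"
            by (rule set_integral_norm_bound[OF int_q[OF Ab]])
          also have "\<dots> \<le> M k" unfolding M_def
            using set_integrable_norm[OF int_q[OF Ab]] int_dom[OF Ab] q_le by (intro set_integral_mono) auto
          finally show "norm (LINT x:A k|lborel. q n x) \<le> M k" .
        qed
        have "(\<lambda>i. C * measure lborel (A i \<inter> {a..b})) sums (C * measure lborel (\<Union>i. A i \<inter> {a..b}))"
        proof (intro sums_mult measure_UNION)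
          show "range (\<lambda>i. A i \<inter> {a..b}) \<subseteq> sets lborel" using Ab by auto
          show "disjoint_family (\<lambda>i. A i \<inter> {a..b})" using union(1) by (fastforce simp: disjoint_family_on_def)
          have "emeasure lborel (\<Union>i. A i \<inter> {a..b}) \<le> emeasure lborel {a..b}" by (intro emeasure_mono) auto
          then show "emeasure lborel (\<Union>i. A i \<inter> {a..b}) \<noteq> \<infinity>"
            using emeasure_lborel_cbox_finite[of a b] by (auto simp: top_unique)
        qed
        then have sm: "summable (\<lambda>i. C * measure lborel (A i \<inter> {a..b}))" by (rule sums_summable)
        moreover have "M = (\<lambda>i. C * measure lborel (A i \<inter> {a..b}))"
        proof
          fix i
          have "M i = (LINT x|lborel. C * indicator (A i \<inter> {a..b}) x)"
            unfolding M_def set_lebesgue_integral_def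
            by (intro Bochner_Integration.integral_cong) (auto simp: indicator_def)
          then show "M i = C * measure lborel (A i \<inter> {a..b})" using Ab by simp
        qed
        ultimately show "summable M" by (simp only:)
      qed (use union in auto)
      moreover have "(LINT x:(\<Union>i. A i)|lborel. q N x) = (\<Sum>i. LINT x:A i|lborel. q N x)" for N
      proof (rule lebesgue_integral_countable_add)
        show "set_integrable lborel (\<Union>i. A i) (q N)" by (rule int_q) (use Ab in auto)
        show "A i \<inter> A j = {}" if "i \<noteq> j" for i j using union(1) that by (auto simp: disjoint_family_on_def)
      qed (use Ab in auto)
      ultimately show ?case by simp
    qed
  qed
  have int_rq: "integrable lborel (\<lambda>x. s x * q N x)" if "integrable lborel s" for s N
  proof (rule Bochner_Integration.integrable_bound)
    show "integrable lborel (\<lambda>x. \<bar>C\<bar> * norm (s x))" using that by simp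
    show "AE x in lborel. norm (s x * q N x) \<le> norm (\<bar>C\<bar> * norm (s x))"
    proof (intro AE_I2)
      fix x
      show "norm (s x * q N x) \<le> norm (\<bar>C\<bar> * norm (s x))"
        using mult_right_mono[OF q_C[of N x] abs_ge_zero[of "s x"]] by (simp add: abs_mult mult.commute)
    qed
  qed (use that in auto)
  from r show ?thesis
  proof (induction r rule: integrable_induct)
    case (base A c)
    have "(LINT x|lborel. indicator A x *\<^sub>R c * q N x) = c * (LINT x:A|lborel. q N x)" for N
      unfolding set_lebesgue_integral_def by (simp add: mult_ac flip: integral_mult_right_zero)
    then show ?case using tendsto_mult_left[OF sets, of A c] base by simp
  next
    case (add f g)
    then show ?case using tendsto_add[OF add(3,4)] int_rq by (simp add: distrib_right)
  next
    case (lim f s)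
    have "(\<lambda>i. LINT x|lborel. norm (f x - s i x)) \<longlonglongrightarrow> (LINT x|(lborel :: real measure). 0)"
    proof (rule integral_dominated_convergence[where w = "\<lambda>x. 3 * norm (f x)"])
      show "AE x in lborel. (\<lambda>i. norm (f x - s i x)) \<longlonglongrightarrow> 0"
        using lim.hyps(2) by (auto intro!: AE_I2 tendsto_eq_intros)
      show "AE x in lborel. norm (norm (f x - s i x)) \<le> 3 * norm (f x)" for i
      proof (intro AE_I2)
        fix x :: real
        show "norm (norm (f x - s i x)) \<le> 3 * norm (f x)"
          using lim.hyps(3)[of x i] norm_triangle_ineq4[of "f x" "s i x"] by simp
      qed
    qed (use lim.hyps in auto)
    then have L1: "(\<lambda>i. LINT x|lborel. norm (f x - s i x)) \<longlonglongrightarrow> 0" by simp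
    show ?case
    proof (rule LIMSEQ_I)
      fix e :: real assume e: "0 < e"
      \<comment> \<open>The summand 1 covers C = 0 and makes
        \<open>\<bar>C\<bar> * e' < e / 2\<close> strict.\<close>
      define e' where "e' = e / (2 * (\<bar>C\<bar> + 1))"
      have e': "0 < e'" using e by (simp add: e'_def)
      obtain i where i: "norm (LINT x|lborel. norm (f x - s i x)) < e'"
        using LIMSEQ_D[OF L1 e'] by auto
      obtain n0 where n0: "\<And>n. n \<ge> n0 \<Longrightarrow> norm (LINT x|lborel. s i x * q n x) < e / 2"
        using LIMSEQ_D[OF lim.IH[of i], of "e / 2"] e by auto
      have "norm (LINT x|lborel. f x * q n x) < e" if "n \<ge> n0" for n
      proof -
        have "(LINT x|lborel. (f x - s i x) * q n x) = (LINT x|lborel. f x * q n x) - (LINT x|lborel. s i x * q n x)"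
          unfolding left_diff_distrib by (intro Bochner_Integration.integral_diff int_rq lim.hyps)
        moreover have "norm (LINT x|lborel. (f x - s i x) * q n x) \<le> (LINT x|lborel. \<bar>C\<bar> * norm (f x - s i x))"
        proof (rule Bochner_Integration.integral_norm_bound_integral)
          fix x
          show "norm ((f x - s i x) * q n x) \<le> \<bar>C\<bar> * norm (f x - s i x)"
            using mult_right_mono[OF q_C[of n x] abs_ge_zero[of "f x - s i x"]] by (simp add: abs_mult mult.commute)
        qed (use int_rq lim.hyps in auto)
        moreover have "(LINT x|lborel. \<bar>C\<bar> * norm (f x - s i x)) \<le> \<bar>C\<bar> * e'"
          using i by (simp add: mult_left_mono)
        moreover have "\<bar>C\<bar> * e' < e / 2" using e by (simp add: e'_def field_simps)
        ultimately show ?thesis using n0[OF that] by simp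
      qed
      then show "\<exists>n0. \<forall>n\<ge>n0. norm ((LINT x|lborel. f x * q n x) - 0) < e" by auto
    qed
  qed
qed

text \<open>Finiteness of the measure makes the Radon-Nikodym derivative finite almost everywhere
  and its real version integrable.\<close>

lemma absolutely_continuous_real_density:
  assumes "finite_measure \<mu>" "absolutely_continuous lborel \<mu>" and sets: "sets \<mu> = sets borel"
  obtains r :: "real \<Rightarrow> real" where "integrable lborel r" "\<And>x. 0 \<le> r x"
    "\<mu> = density lborel (\<lambda>x. ennreal (r x))"
proof -
  interpret finite_measure \<mu> by fact
  have sets': "sets \<mu> = sets lborel" using sets by simp
  from sigma_finite_measure.real_RN_deriv[OF sigma_finite_lborel assms(1,2) sets'] obtain r where
    r: "r \<in> borel_measurable lborel" "AE x in lborel. RN_deriv lborel \<mu> x = ennreal (r x)" "\<And>x. 0 \<le> r x"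
    by blast
  have d: "\<mu> = density lborel (\<lambda>x. ennreal (r x))"
  proof -
    have "\<mu> = density lborel (RN_deriv lborel \<mu>)"
      using sigma_finite_measure.density_RN_deriv[OF sigma_finite_lborel assms(2) sets'] by simp
    also have "\<dots> = density lborel (\<lambda>x. ennreal (r x))"
      by (rule density_cong) (use r in auto)
    finally show ?thesis .
  qed
  have "(\<integral>\<^sup>+ x. ennreal (r x) \<partial>lborel) = emeasure \<mu> UNIV"
    unfolding d using r(1) by (simp add: emeasure_density)
  then have "integrable lborel r"
    using r emeasure_finite[of UNIV] by (intro integrableI_nonneg) (auto simp: less_top[symmetric])
  then show ?thesis using that r(3) d by blast
qed

lemma is_acim_integral_tent_iter:
  fixes g :: "real \<Rightarrow> real"
  assumes mu: "is_acim t \<mu>" and g: "continuous_on UNIV g"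
  shows "(LINT x|\<mu>. g ((tent t ^^ n) x)) = (LINT x|\<mu>. g x)"
proof (induction n)
  case (Suc n)
  have sets: "sets \<mu> = sets borel" and inv: "distr \<mu> borel (tent t) = \<mu>"
    using mu by (auto simp: is_acim_def)
  have tm: "tent t \<in> measurable \<mu> borel"
    unfolding measurable_cong_sets[OF sets refl]
    by (rule borel_measurable_continuous_onI) (auto intro!: continuous_intros)
  have gm: "(\<lambda>x. g ((tent t ^^ n) x)) \<in> borel_measurable borel"
    by (rule borel_measurable_continuous_onI[OF continuous_comp_tent_iter[OF g]])
  have "(LINT x|\<mu>. g ((tent t ^^ n) x)) = (LINT x|distr \<mu> borel (tent t). g ((tent t ^^ n) x))"
    by (simp add: inv)
  also have "\<dots> = (LINT x|\<mu>. g ((tent t ^^ n) (tent t x)))"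
    by (rule integral_distr[OF tm gm])
  finally show ?case using Suc by (simp add: funpow_Suc_right del: funpow.simps)
qed simp

lemma is_acim_AE_Iint:
  assumes "is_acim t \<mu>"
  shows "AE x in \<mu>. x \<in> Iint"
proof -
  interpret prob_space \<mu> using assms by (simp add: is_acim_def)
  have "prob Iint = 1" using assms by (simp add: is_acim_def measure_def)
  then show ?thesis using AE_prob_1 by blast
qed

lemma is_acim_integrable:
  fixes g :: "real \<Rightarrow> real"
  assumes mu: "is_acim t \<mu>" and g: "continuous_on UNIV g" and B: "\<And>x. x \<in> Iint \<Longrightarrow> \<bar>g x\<bar> \<le> B"
  shows "integrable \<mu> g"
proof -
  interpret prob_space \<mu> using mu by (simp add: is_acim_def)
  have sets: "sets \<mu> = sets borel" using mu by (auto simp: is_acim_def)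
  have "g \<in> borel_measurable \<mu>"
    unfolding measurable_cong_sets[OF sets refl] by (rule borel_measurable_continuous_onI[OF g])
  moreover have "AE x in \<mu>. norm (g x) \<le> B"
    using is_acim_AE_Iint[OF mu] by eventually_elim (use B in auto)
  ultimately show ?thesis by (intro integrable_const_bound)
qed

text \<open>The sequence does not depend on the measure, so this contains its uniqueness.\<close>

lemma is_acim_birkhoff_limit:
  assumes t: "1 < t" "t \<le> 2" and mu: "is_acim t \<mu>"
    and g: "continuous_on UNIV g" and B: "\<And>x. x \<in> Iint \<Longrightarrow> \<bar>g x\<bar> \<le> B"
  shows "(\<lambda>N. birkhoff_tail t g N (-1) / (2 * real N)) \<longlonglongrightarrow> (LINT x|\<mu>. g x)"
proof -
  interpret prob_space \<mu> using mu by (simp add: is_acim_def)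
  have sets: "sets \<mu> = sets borel" using mu by (auto simp: is_acim_def)
  obtain r where r: "integrable lborel r" "\<And>x. 0 \<le> r x" "\<mu> = density lborel (\<lambda>x. ennreal (r x))"
    using absolutely_continuous_real_density[of \<mu>] mu finite_measure_axioms by (auto simp: is_acim_def)
  \<comment> \<open>\<open>c N\<close> is the Lebesgue mean over \<open>Iint\<close> of the Birkhoff
    average of g, \<open>p N\<close> the average minus this mean, and \<open>q N\<close> its
    restriction to \<open>Iint\<close>.\<close>
  define c where "c N = birkhoff_tail t g N (-1) / (2 * real N)" for N
  define p where "p N x = (\<Sum>n<N. g ((tent t ^^ n) x)) / real N - c N" for N x
  define q where "q N x = indicator Iint x * p N x" for N x
  have B0: "0 \<le> B" using B[of 0] by (auto simp: Iint_def)
  have p_cont: "continuous_on S (p N)" for N S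
    unfolding p_def divide_inverse
    by (intro continuous_intros continuous_on_subset[OF continuous_comp_tent_iter[OF g]]) auto
  have p_meas [measurable]: "p N \<in> borel_measurable borel" for N
    by (rule borel_measurable_continuous_onI[OF p_cont])
  have q_meas [measurable]: "q N \<in> borel_measurable borel" for N
    unfolding q_def Iint_def by measurable
  have c_le: "\<bar>c N\<bar> \<le> B" for N
    using abs_birkhoff_tail_le[OF t g B, of "-1" N] B0
    by (cases "N = 0") (auto simp: c_def Iint_def field_simps)
  have p_le: "\<bar>p N x\<bar> \<le> 2 * B" if "x \<in> Iint" for N x
  proof -
    have "\<bar>\<Sum>n<N. g ((tent t ^^ n) x)\<bar> \<le> (\<Sum>n<N. \<bar>g ((tent t ^^ n) x)\<bar>)" by (rule sum_abs)
    also have "\<dots> \<le> of_nat (card {..<N}) * B"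
      by (rule sum_bounded_above) (use B tent_iter_mem_Iint[OF t that] in auto)
    finally have "\<bar>(\<Sum>n<N. g ((tent t ^^ n) x)) / real N\<bar> \<le> B"
      using B0 by (cases "N = 0") (auto simp: field_simps)
    then show ?thesis using c_le[of N] unfolding p_def by linarith
  qed
  have "(\<lambda>N. LINT x|lborel. r x * q N x) \<longlonglongrightarrow> 0"
  proof (rule weak_null_integrable[OF _ _ _ r(1)])
    show "q N \<in> borel_measurable borel" for N by (rule q_meas)
    show "\<bar>q N x\<bar> \<le> 2 * B * indicator {-1..1} x" for N x
      using p_le[of x N] by (auto simp: q_def Iint_def indicator_def)
    show "(\<lambda>N. LINT x:{a..}|lborel. q N x) \<longlonglongrightarrow> 0" for a
    proof (cases "a \<le> 1")
      case False
      then have "(LINT x:{a..}|lborel. q N x) = 0" for N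
        unfolding set_lebesgue_integral_def
        by (intro integral_eq_zero_AE AE_I2) (auto simp: q_def Iint_def indicator_def)
      then show ?thesis by simp
    next
      case True
      \<comment> \<open>Within \<open>Iint\<close> the ray from a is the end interval from
        b.\<close>
      define b where "b = max a (-1)"
      have b: "b \<in> Iint" using True by (auto simp: b_def Iint_def)
      have "(LINT x:{a..}|lborel. q N x) = (birkhoff_tail t g N b - (1 - b) / 2 * birkhoff_tail t g N (-1)) / real N" for N
      proof -
        have "(LINT x:{a..}|lborel. q N x) = (LINT x:{b..1}|lborel. p N x)"
          unfolding set_lebesgue_integral_def
          by (intro Bochner_Integration.integral_cong) (auto simp: q_def Iint_def indicator_def b_def)
        also have "\<dots> = integral {b..1} (p N)"
          by (intro set_borel_integral_eq_integral borel_integrable_atLeastAtMost')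
             (use p_cont in auto)
        also have "\<dots> = birkhoff_tail t g N b / real N - c N * (1 - b)"
        proof -
          have i: "(\<lambda>x. g ((tent t ^^ n) x)) integrable_on {b..1}" for n
            by (intro integrable_continuous_interval continuous_on_subset[OF continuous_comp_tent_iter[OF g]]) auto
          then have "integral {b..1} (p N) = integral {b..1} (\<lambda>x. (\<Sum>n<N. g ((tent t ^^ n) x)) / real N) - integral {b..1} (\<lambda>x. c N)"
            unfolding p_def by (intro integral_diff integrable_on_divide integrable_sum) auto
          then show ?thesis
            using b i by (simp add: integral_sum birkhoff_tail_def tail_integral_def Iint_def)
        qed
        finally show ?thesis by (cases "N = 0") (auto simp: c_def birkhoff_tail_def field_simps)
      qed
      moreover have "(\<lambda>N. (birkhoff_tail t g N b - (1 - b) / 2 * birkhoff_tail t g N (-1)) / real N) \<longlonglongrightarrow> 0"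
      proof (rule Lim_null_comparison)
        show "\<forall>\<^sub>F N in sequentially. norm ((birkhoff_tail t g N b - (1 - b) / 2 * birkhoff_tail t g N (-1)) / real N)
            \<le> 4 * B * t / (t - 1) / real N"
          unfolding real_norm_def abs_divide abs_of_nat
          by (intro always_eventually allI divide_right_mono birkhoff_tail_proportional[OF t g B b]) auto
        show "(\<lambda>N. 4 * B * t / (t - 1) / real N) \<longlonglongrightarrow> 0" by (rule lim_const_over_n)
      qed
      ultimately show ?thesis by simp
    qed
  qed
  \<comment> \<open>By invariance every Birkhoff average with N > 0 has the same
    \<open>\<mu>\<close>-integral as g; at N = 0 the quotient is 0 instead.\<close>
  moreover have "\<forall>\<^sub>F N in sequentially. (LINT x|lborel. r x * q N x) = (LINT x|\<mu>. g x) - c N"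
    using eventually_gt_at_top[of 0]
  proof eventually_elim
    case (elim N)
    have "(LINT x|lborel. r x * q N x) = (LINT x|\<mu>. q N x)"
      unfolding r(3) using r(1,2) by (subst integral_density) auto
    also have "\<dots> = (LINT x|\<mu>. p N x)"
    proof (rule integral_cong_AE)
      show "AE x in \<mu>. q N x = p N x"
        using is_acim_AE_Iint[OF mu] by eventually_elim (simp add: q_def)
    qed (unfold measurable_cong_sets[OF sets refl], auto)
    also have "\<dots> = (LINT x|\<mu>. g x) - c N"
    proof -
      have i: "integrable \<mu> (\<lambda>x. g ((tent t ^^ n) x))" for n
        by (rule is_acim_integrable[OF mu continuous_comp_tent_iter[OF g], where B = B])
           (use B tent_iter_mem_Iint[OF t] in auto)
      then show ?thesis
        using elim by (simp add: p_def is_acim_integral_tent_iter[OF mu g] prob_space)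
    qed
    finally show ?case .
  qed
  ultimately have "(\<lambda>N. (LINT x|\<mu>. g x) - c N) \<longlonglongrightarrow> 0"
    using Lim_transform_eventually by fast
  then have "(\<lambda>N. (LINT x|\<mu>. g x) - ((LINT x|\<mu>. g x) - c N)) \<longlonglongrightarrow> (LINT x|\<mu>. g x) - 0"
    by (intro tendsto_intros)
  then show ?thesis by (simp add: c_def)
qed

text \<open>The averages tend both to the integral of g and to
  \<open>orb_functional t g / orb_mass t\<close>, so the two agree. The functional supplies the
  rate, uniform in t by the lower bound for the mass.\<close>

lemma is_acim_birkhoff_estimate:
  assumes \<tau>: "1 < \<tau>"
  obtains K where "\<And>t \<mu> g B N. \<tau> \<le> t \<Longrightarrow> t \<le> 2 \<Longrightarrow> is_acim t \<mu> \<Longrightarrow> continuous_on UNIV g \<Longrightarrow>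
      (\<And>x. x \<in> Iint \<Longrightarrow> \<bar>g x\<bar> \<le> B) \<Longrightarrow> 0 < N \<Longrightarrow>
      \<bar>(LINT x|\<mu>. g x) - birkhoff_tail t g N (-1) / (2 * real N)\<bar> \<le> K * B / real N"
proof -
  obtain \<delta> where \<delta>: "\<delta> > 0" "\<And>t. \<tau> \<le> t \<Longrightarrow> t \<le> 2 \<Longrightarrow> \<delta> \<le> orb_mass t"
    using orb_mass_lower_bound[OF \<tau>] by blast
  \<comment> \<open>Uses \<open>t / (t - 1) \<le> 2 / (\<tau> - 1)\<close> and
    \<open>\<delta> \<le> orb_mass t\<close>.\<close>
  define K where "K = 4 * (2 / (\<tau> - 1))\<^sup>2 / \<delta>"
  have "\<bar>(LINT x|\<mu>. g x) - birkhoff_tail t g N (-1) / (2 * real N)\<bar> \<le> K * B / real N"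
    if t: "\<tau> \<le> t" "t \<le> 2" and mu: "is_acim t \<mu>" and g: "continuous_on UNIV g"
      and B: "\<And>x. x \<in> Iint \<Longrightarrow> \<bar>g x\<bar> \<le> B" and N: "0 < N" for t \<mu> g B N
  proof -
    have t1: "1 < t" using t \<tau> by simp
    have B0: "0 \<le> B" using B[of 0] by (auto simp: Iint_def)
    define m where "m = orb_mass t"
    have m: "\<delta> \<le> m" "0 < m" using \<delta> t unfolding m_def by (blast, smt (verit))
    have est: "\<bar>orb_functional t g / m - birkhoff_tail t g N (-1) / (2 * real N)\<bar> \<le> K * B / real N"
      if N: "0 < N" for N
    proof -
      have "\<bar>orb_functional t g / m - birkhoff_tail t g N (-1) / (2 * real N)\<bar>
          = \<bar>(real N * orb_functional t g - m * birkhoff_tail t g N (-1) / 2) / (m * real N)\<bar>"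
        using N m by (intro arg_cong[where f = abs]) (simp add: field_simps)
      also have "\<dots> = \<bar>real N * orb_functional t g - m * birkhoff_tail t g N (-1) / 2\<bar> / (m * real N)"
        using N m by (simp add: abs_mult)
      also have "\<dots> \<le> 4 * B * (t / (t - 1))\<^sup>2 / (m * real N)"
        using orb_functional_conv_birkhoff[OF t1 t(2) g B, of N] m by (simp add: m_def divide_right_mono)
      also have "\<dots> \<le> 4 * B * (2 / (\<tau> - 1))\<^sup>2 / (\<delta> * real N)"
        using B0 t \<tau> m \<delta>(1) N
        by (intro frac_le mult_left_mono power_mono mult_right_mono) auto
      finally show ?thesis by (simp add: K_def mult_ac)
    qed
    have "(\<lambda>N. birkhoff_tail t g N (-1) / (2 * real N)) \<longlonglongrightarrow> orb_functional t g / m"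
    proof (rule Lim_transform2[OF tendsto_const Lim_null_comparison])
      show "\<forall>\<^sub>F N in sequentially. norm (orb_functional t g / m - birkhoff_tail t g N (-1) / (2 * real N)) \<le> K * B / real N"
        using eventually_gt_at_top[of 0] by eventually_elim (use est in simp)
      show "(\<lambda>N. K * B / real N) \<longlonglongrightarrow> 0" by (rule lim_const_over_n)
    qed
    then have "(LINT x|\<mu>. g x) = orb_functional t g / m"
      using is_acim_birkhoff_limit[OF t1 t(2) mu g B] LIMSEQ_unique by blast
    then show ?thesis using est[OF N] by simp
  qed
  then show ?thesis using that by blast
qed

text \<open>The test function may depend on t because coordinates of the inverse limit are later
  rebuilt with iterates of \<open>tent t\<close>. The proof fixes N by the uniform estimate and then
  uses continuity of the N-th average in t.\<close>

lemma is_acim_weakly_continuous: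
  fixes G :: "real \<Rightarrow> real \<Rightarrow> real"
  assumes mu: "\<And>t. t \<in> Jint \<Longrightarrow> is_acim t (\<mu> t)"
    and G: "continuous_on UNIV (\<lambda>(x, t). G x t)" and B: "\<And>x t. \<bar>G x t\<bar> \<le> B"
    and ts: "\<And>i. ts i \<in> Jint" and t0: "t0 \<in> Jint" and lim: "ts \<longlonglongrightarrow> t0"
  shows "(\<lambda>i. LINT x|\<mu> (ts i). G x (ts i)) \<longlonglongrightarrow> (LINT x|\<mu> t0. G x t0)"
proof -
  \<comment> \<open>The midpoint of 1 and \<open>t0\<close>: eventually \<open>ts i\<close> exceeds
    it, which gives one constant K for the tail of the sequence.\<close>
  define \<tau> where "\<tau> = (1 + t0) / 2"
  have \<tau>: "1 < \<tau>" "\<tau> < t0" using t0 by (auto simp: \<tau>_def Jint_def)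
  obtain K where K: "\<And>t \<mu> g B N. \<tau> \<le> t \<Longrightarrow> t \<le> 2 \<Longrightarrow> is_acim t \<mu> \<Longrightarrow> continuous_on UNIV g \<Longrightarrow>
      (\<And>x. x \<in> Iint \<Longrightarrow> \<bar>g x\<bar> \<le> B) \<Longrightarrow> 0 < N \<Longrightarrow>
      \<bar>(LINT x|\<mu>. g x) - birkhoff_tail t g N (-1) / (2 * real N)\<bar> \<le> K * B / real N"
    using is_acim_birkhoff_estimate[OF \<tau>(1)] by blast
  define S where "S N t = birkhoff_tail t (\<lambda>x. G x t) N (-1) / (2 * real N)" for N t
  have Gc: "continuous_on UNIV (\<lambda>x. G x t)" for t
    using continuous_on_compose2[OF G, of UNIV "\<lambda>x. (x, t)"]
    by (simp add: continuous_on_Pair continuous_on_id continuous_on_const)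
  have est: "\<bar>(LINT x|\<mu> t. G x t) - S N t\<bar> \<le> K * B / real N" if "t \<in> Jint" "\<tau> \<le> t" "0 < N" for t N
    unfolding S_def by (rule K) (use that mu Gc B in \<open>auto simp: Jint_def\<close>)
  have Sc: "(\<lambda>i. S N (ts i)) \<longlonglongrightarrow> S N t0" for N
  proof -
    have "continuous_on UNIV (\<lambda>t. integral (cbox (-1) 1) (\<lambda>x. G ((tent t ^^ n) x) t))" for n
    proof (rule integral_continuous_on_param)
      have "continuous_on (UNIV \<times> cbox (-1) 1) (\<lambda>z. (\<lambda>(x, t). G x t) ((tent (fst z) ^^ n) (snd z), fst z))"
        by (rule continuous_on_compose2[OF G]) (auto intro!: continuous_intros)
      then show "continuous_on (UNIV \<times> cbox (-1) 1) (\<lambda>(t, x). G ((tent t ^^ n) x) t)"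
        by (simp add: case_prod_beta)
    qed
    then have "(\<lambda>i. tail_integral (\<lambda>x. G ((tent (ts i) ^^ n) x) (ts i)) (-1))
        \<longlonglongrightarrow> tail_integral (\<lambda>x. G ((tent t0 ^^ n) x) t0) (-1)" for n
      unfolding tail_integral_def cbox_interval
      using lim by (rule continuous_on_tendsto_compose) auto
    then show ?thesis unfolding S_def birkhoff_tail_def divide_inverse by (intro tendsto_intros)
  qed
  show ?thesis
  proof (rule LIMSEQ_I)
    fix e :: real assume e: "0 < e"
    obtain N :: nat where N: "0 < N" "K * B / real N < e / 3"
    proof -
      have "(\<lambda>N. K * B / real N) \<longlonglongrightarrow> 0" by (rule lim_const_over_n)
      then have "\<forall>\<^sub>F N in sequentially. K * B / real N < e / 3" by (rule order_tendstoD) (use e in simp)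
      then have "\<forall>\<^sub>F N in sequentially. 0 < N \<and> K * B / real N < e / 3"
        using eventually_gt_at_top[of 0] by eventually_elim simp
      then show ?thesis using that by (auto dest: eventually_happens)
    qed
    have "\<forall>\<^sub>F i in sequentially. \<bar>S N (ts i) - S N t0\<bar> < e / 3"
      using tendstoD[OF Sc, of "e / 3"] e by (simp add: dist_real_def)
    moreover have "\<forall>\<^sub>F i in sequentially. \<tau> < ts i" using lim \<tau>(2) by (rule order_tendstoD)
    ultimately have "\<forall>\<^sub>F i in sequentially. norm ((LINT x|\<mu> (ts i). G x (ts i)) - (LINT x|\<mu> t0. G x t0)) < e"
    proof eventually_elim
      case (elim i)
      then show ?case
        using est[OF ts less_imp_le N(1), of i] est[OF t0 less_imp_le[OF \<tau>(2)] N(1)] N(2)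
        unfolding real_norm_def by linarith
    qed
    then show "\<exists>n0. \<forall>n\<ge>n0. norm ((LINT x|\<mu> (ts n). G x (ts n)) - (LINT x|\<mu> t0. G x t0)) < e"
      by (simp add: eventually_sequentially)
  qed
qed

section \<open>Inverse limits\<close>

text \<open>A product of disks times an interval is compact, so \<open>\<Phi>\<close> is uniformly
  continuous there, and the product metric gives little weight to far coordinates.\<close>

lemma truncation_uniform:
  fixes \<Phi> :: "(nat \<Rightarrow> complex) \<times> real \<Rightarrow> real"
  assumes cont: "continuous_on UNIV \<Phi>" and e: "0 < e"
  obtains N where "\<And>x t. (\<And>n. x n \<in> cball 0 1) \<Longrightarrow> t \<in> {a..b} \<Longrightarrow>
    \<bar>\<Phi> (x, t) - \<Phi> (\<lambda>k. if k \<le> N then x k else 0, t)\<bar> < e"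
proof -
  define Q where "Q = {x :: nat \<Rightarrow> complex. \<forall>n. x n \<in> cball 0 1}"
  have "compactin (product_topology (\<lambda>_::nat. euclidean :: complex topology) UNIV) (PiE UNIV (\<lambda>_. cball 0 1))"
    unfolding compactin_PiE by simp
  moreover have "PiE UNIV (\<lambda>_::nat. cball (0::complex) 1) = Q"
    by (auto simp: Q_def PiE_def Pi_def)
  ultimately have "compact Q" by (simp add: euclidean_product_topology)
  then have "compact (Q \<times> {a..b})" by (intro compact_Times) auto
  then have "uniformly_continuous_on (Q \<times> {a..b}) \<Phi>"
    by (intro compact_uniformly_continuous continuous_on_subset[OF cont]) auto
  then obtain d where d: "d > 0"
    "\<And>y z. y \<in> Q \<times> {a..b} \<Longrightarrow> z \<in> Q \<times> {a..b} \<Longrightarrow> dist z y < d \<Longrightarrow> dist (\<Phi> z) (\<Phi> y) < e"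
    using e unfolding uniformly_continuous_on_def by metis
  obtain M where M: "(1 / 2 :: real) ^ M < d" using real_arch_pow_inv[OF d(1), of "1 / 2"] by auto
  \<comment> \<open>The metric orders the coordinates by \<open>from_nat\<close>; N bounds the first
    M + 1 indices in that order.\<close>
  define N where "N = Max ((from_nat :: nat \<Rightarrow> nat) ` {..M})"
  have "\<bar>\<Phi> (x, t) - \<Phi> (\<lambda>k. if k \<le> N then x k else 0, t)\<bar> < e"
    if x: "\<And>n. x n \<in> cball 0 1" and t: "t \<in> {a..b}" for x t
  proof -
    let ?y = "\<lambda>k. if k \<le> N then x k else 0"
    have "{dist (x (from_nat n)) (?y (from_nat n)) |n. n \<le> M} = {0}"
      by (auto simp: N_def)
    then have "dist x ?y \<le> (1 / 2) ^ M"
      using dist_fun_le_dist_first_terms[of x ?y M] by simp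
    then have "dist (x, t) (?y, t) < d" using M by (simp add: dist_Pair_Pair)
    then have "dist (\<Phi> (x, t)) (\<Phi> (?y, t)) < e"
      by (intro d(2)) (use x t in \<open>auto simp: Q_def\<close>)
    then show ?thesis by (simp add: dist_real_def)
  qed
  then show ?thesis using that by blast
qed

lemma Ihat_coordinate:
  assumes "x \<in> Ihat t"
  shows "x m = complex_of_real ((tent t ^^ j) (Re (x (m + j))))"
proof (induction j)
  case 0
  have "x m \<in> complex_of_real ` Iint" using assms by (simp add: Ihat_def)
  then show ?case by auto
next
  case (Suc j)
  have "complex_of_real (tent t (Re (x (Suc (m + j))))) = x (m + j)"
    using assms by (simp add: Ihat_def)
  from this[symmetric] have "Re (x (m + j)) = tent t (Re (x (m + Suc j)))" by simp
  then show ?case using Suc by (simp add: funpow_Suc_right del: funpow.simps)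
qed

text \<open>Closedness jointly in x and t is what permits the Tietze extension of the test function
  from this graph.\<close>

lemma closed_Ihat_graph: "closed {(x, t). t \<in> {a..b} \<and> x \<in> Ihat t}"
proof -
  have c: "continuous_on UNIV (\<lambda>z::(nat \<Rightarrow> complex) \<times> real. fst z n)" for n
    by (rule continuous_on_product_then_coordinatewise) (intro continuous_intros)
  have "closed (complex_of_real ` Iint)"
    by (intro compact_imp_closed compact_continuous_image) (auto simp: Iint_def intro!: continuous_intros)
  then have "closed ((\<lambda>z::(nat \<Rightarrow> complex) \<times> real. fst z n) -` (complex_of_real ` Iint))" for n
    by (rule continuous_closed_vimage) (use c[THEN continuous_on_imp_continuous_within] in auto)
  moreover have "closed {z::(nat \<Rightarrow> complex) \<times> real. complex_of_real (tent (snd z) (Re (fst z (Suc n)))) = fst z n}" for n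
    by (intro closed_Collect_eq continuous_intros c)
  moreover have "closed {z::(nat \<Rightarrow> complex) \<times> real. snd z \<in> {a..b}}"
    unfolding atLeastAtMost_iff by (intro closed_Collect_conj closed_Collect_le continuous_intros)
  ultimately have "closed ({z. snd z \<in> {a..b}} \<inter> (\<Inter>n. ((\<lambda>z. fst z n) -` (complex_of_real ` Iint)) \<inter>
      {z. complex_of_real (tent (snd z) (Re (fst z (Suc n)))) = fst z n}))"
    by (intro closed_Int closed_INT) auto
  also have "({z. snd z \<in> {a..b}} \<inter> (\<Inter>n. ((\<lambda>z. fst z n) -` (complex_of_real ` Iint)) \<inter>
      {z. complex_of_real (tent (snd z) (Re (fst z (Suc n)))) = fst z n})) = {(x, t). t \<in> {a..b} \<and> x \<in> Ihat t}"
    by (auto simp: Ihat_def)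
  finally show ?thesis .
qed

lemma Ihat_subset_Dhat:
  assumes "unwrapping P fbar" "t \<in> Jint"
  shows "Ihat t \<subseteq> Dhat P fbar t"
proof
  fix x assume x: "x \<in> Ihat t"
  show "x \<in> Dhat P fbar t" unfolding Dhat_def
  proof (intro CollectI allI conjI)
    fix n
    obtain y where y: "x (Suc n) = complex_of_real y" "y \<in> Iint" using x by (auto simp: Ihat_def)
    have "Hmap P fbar t (x (Suc n)) = complex_of_real (tent t y)"
      using assms y by (simp add: unwrapping_def Hmap_def)
    moreover have "complex_of_real (tent t (Re (x (Suc n)))) = x n" using x by (simp add: Ihat_def)
    ultimately show "Hmap P fbar t (x (Suc n)) = x n" using y by simp
    have "x n \<in> complex_of_real ` Iint" using x by (simp add: Ihat_def)
    then show "x n \<in> cball 0 2" by (auto simp: Iint_def)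
  qed
qed

text \<open>The induced measure is carried by \<open>Ihat t\<close>, so the pulled-back test
  function may be replaced by any continuous \<open>\<Phi>\<close> agreeing with it there.\<close>

lemma nu_meas_integral:
  fixes P fbar h and \<alpha> :: "complex \<Rightarrow> real"
  assumes unwr: "unwrapping P fbar" and t: "t \<in> Jint"
    and homeo: "homeomorphism (Dhat P fbar t) (cball 0 1) (h t) g"
    and ind: "is_induced_measure t (mu t) (hmu t)"
    and \<alpha>: "continuous_on (cball 0 1) \<alpha>"
    and \<Phi>: "continuous_on UNIV \<Phi>" "\<And>x. x \<in> Ihat t \<Longrightarrow> \<Phi> x = \<alpha> (h t x)"
  shows "(LINT z|nu_meas P fbar h hmu t. \<alpha> z) = (LINT x|hmu t. \<Phi> x)"
proof -
  let ?D = "Dhat P fbar t"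
  have sets: "sets (hmu t) = sets borel" and AE: "AE x in hmu t. x \<in> Ihat t"
    using ind by (auto simp: is_induced_measure_def)
  have space: "space (hmu t) = UNIV" using sets_eq_imp_space_eq[OF sets] by simp
  \<comment> \<open>\<open>Dhat\<close> is compact as a homeomorphic image of the disk, hence closed
    and Borel.\<close>
  have "compact (g ` cball 0 1)"
    using homeo by (intro compact_continuous_image) (auto simp: homeomorphism_def)
  then have "closed ?D" using homeo by (auto simp: homeomorphism_def intro: compact_imp_closed)
  then have D: "?D \<in> sets (hmu t)" unfolding sets by (rule borel_closed)
  have hc: "continuous_on ?D (h t)" and hi: "h t ` ?D = cball 0 1"
    using homeo by (auto simp: homeomorphism_def)
  have rs: "sets (restrict_space (hmu t) ?D) = sets (restrict_space borel ?D)"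
    by (rule sets_restrict_space_cong[OF sets])
  have hm: "h t \<in> measurable (restrict_space (hmu t) ?D) (restrict_space borel (cball 0 1))"
  proof (rule measurable_restrict_space2)
    show "h t \<in> space (restrict_space (hmu t) ?D) \<rightarrow> cball 0 1"
      using hi by (auto simp: space_restrict_space)
    show "h t \<in> borel_measurable (restrict_space (hmu t) ?D)"
      unfolding measurable_cong_sets[OF rs refl] by (rule borel_measurable_continuous_on_restrict[OF hc])
  qed
  have \<alpha>m: "\<alpha> \<in> borel_measurable (restrict_space borel (cball 0 1))"
    by (rule borel_measurable_continuous_on_restrict[OF \<alpha>])
  have "(LINT z|nu_meas P fbar h hmu t. \<alpha> z) = (LINT x|restrict_space (hmu t) ?D. \<alpha> (h t x))"
    unfolding nu_meas_def by (rule integral_distr[OF hm \<alpha>m])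
  also have "\<dots> = (LINT x|hmu t. indicator ?D x *\<^sub>R \<alpha> (h t x))"
    by (rule integral_restrict_space) (use D space in simp)
  also have "\<dots> = (LINT x|hmu t. \<Phi> x)"
  proof (rule integral_cong_AE)
    show "(\<lambda>x. indicator ?D x *\<^sub>R \<alpha> (h t x)) \<in> borel_measurable (hmu t)"
      using measurable_compose[OF hm \<alpha>m] D space by (subst borel_measurable_restrict_space_iff[symmetric]) auto
    show "\<Phi> \<in> borel_measurable (hmu t)"
      unfolding measurable_cong_sets[OF sets refl] by (rule borel_measurable_continuous_onI[OF \<Phi>(1)])
    show "AE x in hmu t. indicator ?D x *\<^sub>R \<alpha> (h t x) = \<Phi> x"
      using AE by eventually_elim (use Ihat_subset_Dhat[OF unwr t] \<Phi>(2) in auto)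
  qed
  finally show ?thesis .
qed

text \<open>On \<open>Ihat t\<close> the coordinates up to N are functions of coordinate N, whose
  distribution is \<open>mu t\<close>. Up to \<open>e / 3\<close> the integral of
  \<open>\<Phi>\<close> is therefore an integral over the interval.\<close>

lemma induced_measures_weakly_continuous:
  fixes \<Phi> :: "(nat \<Rightarrow> complex) \<times> real \<Rightarrow> real"
  assumes mu: "\<And>t. t \<in> Jint \<Longrightarrow> is_acim t (mu t)"
    and ind: "\<And>t. t \<in> Jint \<Longrightarrow> is_induced_measure t (mu t) (hmu t)"
    and \<Phi>: "continuous_on UNIV \<Phi>" and B: "\<And>z. \<bar>\<Phi> z\<bar> \<le> B"
    and ts: "\<And>i. ts i \<in> Jint" and t0: "t0 \<in> Jint" and lim: "ts \<longlonglongrightarrow> t0"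
  shows "(\<lambda>i. LINT x|hmu (ts i). \<Phi> (x, ts i)) \<longlonglongrightarrow> (LINT x|hmu t0. \<Phi> (x, t0))"
proof (rule LIMSEQ_I)
  fix e :: real assume e: "0 < e"
  obtain N where N: "\<And>x t. (\<And>n. x n \<in> cball 0 1) \<Longrightarrow> t \<in> {1..2} \<Longrightarrow>
      \<bar>\<Phi> (x, t) - \<Phi> (\<lambda>k. if k \<le> N then x k else 0, t)\<bar> < e / 3"
    using truncation_uniform[OF \<Phi>, of "e / 3" 1 2] e by auto
  \<comment> \<open>Rebuilds the truncated sequence from its coordinate N by iterating forward; it
    is jointly continuous in y and t.\<close>
  define hist where "hist y t = (\<lambda>k. if k \<le> N then complex_of_real ((tent t ^^ (N - k)) y) else 0)" for y t
  define G where "G y t = \<Phi> (hist y t, t)" for y t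
  have hist: "continuous_on UNIV (\<lambda>z. hist (fst z) (snd z))"
  proof (rule continuous_on_coordinatewise_then_product)
    show "continuous_on UNIV (\<lambda>z. hist (fst z) (snd z) k)" for k
      by (cases "k \<le> N") (auto simp: hist_def intro!: continuous_intros)
  qed
  have G: "continuous_on UNIV (\<lambda>(y, t). G y t)"
  proof -
    have "continuous_on UNIV (\<lambda>z. \<Phi> (hist (fst z) (snd z), snd z))"
      by (rule continuous_on_compose2[OF \<Phi>]) (auto intro!: continuous_intros hist)
    then show ?thesis by (simp add: G_def case_prod_beta)
  qed
  have Gt: "continuous_on UNIV (\<lambda>y. G y t)" for t
    using continuous_on_compose2[OF G, of UNIV "\<lambda>y. (y, t)"]
    by (simp add: continuous_on_Pair continuous_on_id continuous_on_const)
  have est: "\<bar>(LINT x|hmu t. \<Phi> (x, t)) - (LINT y|mu t. G y t)\<bar> \<le> e / 3" if t: "t \<in> Jint" for t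
  proof -
    interpret prob_space "hmu t" using ind[OF t] by (simp add: is_induced_measure_def)
    have sets: "sets (hmu t) = sets borel" and AE: "AE x in hmu t. x \<in> Ihat t"
      and dist: "distr (hmu t) borel (\<lambda>x. Re (x N)) = mu t"
      using ind[OF t] by (auto simp: is_induced_measure_def)
    have Rem: "(\<lambda>x. Re (x N)) \<in> borel_measurable (hmu t)"
      unfolding measurable_cong_sets[OF sets refl]
      by (rule borel_measurable_continuous_onI) (intro continuous_intros continuous_on_product_coordinates)
    have Gm: "(\<lambda>y. G y t) \<in> borel_measurable borel" by (rule borel_measurable_continuous_onI[OF Gt])
    have \<Phi>m: "(\<lambda>x. \<Phi> (x, t)) \<in> borel_measurable (hmu t)"
      unfolding measurable_cong_sets[OF sets refl]
      by (intro borel_measurable_continuous_onI continuous_on_compose2[OF \<Phi>] continuous_intros) auto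
    have i\<Phi>: "integrable (hmu t) (\<lambda>x. \<Phi> (x, t))"
      by (rule integrable_const_bound[of _ B]) (use B \<Phi>m in auto)
    have iG: "integrable (hmu t) (\<lambda>x. G (Re (x N)) t)"
      by (rule integrable_const_bound[of _ B]) (use B measurable_compose[OF Rem Gm] in \<open>auto simp: G_def\<close>)
    have "(LINT y|mu t. G y t) = (LINT x|hmu t. G (Re (x N)) t)"
      by (subst dist[symmetric]) (rule integral_distr[OF Rem Gm])
    then have "(LINT x|hmu t. \<Phi> (x, t)) - (LINT y|mu t. G y t) = (LINT x|hmu t. \<Phi> (x, t) - G (Re (x N)) t)"
      using i\<Phi> iG by simp
    also have "\<bar>\<dots>\<bar> \<le> (LINT x|hmu t. \<bar>\<Phi> (x, t) - G (Re (x N)) t\<bar>)" by (rule integral_abs_bound)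
    also have "\<dots> \<le> (LINT x|hmu t. e / 3)"
    proof (rule integral_mono_AE)
      show "AE x in hmu t. \<bar>\<Phi> (x, t) - G (Re (x N)) t\<bar> \<le> e / 3"
        using AE
      proof eventually_elim
        case (elim x)
        have hist_x: "x k = complex_of_real ((tent t ^^ (N - k)) (Re (x N)))" if "k \<le> N" for k
          using Ihat_coordinate[OF elim, of k "N - k"] that by simp
        have "hist (Re (x N)) t = (\<lambda>k. if k \<le> N then x k else 0)"
          unfolding hist_def by (intro ext if_cong refl hist_x[symmetric])
        moreover have "x n \<in> cball 0 1" for n
        proof -
          have "x n \<in> complex_of_real ` Iint" using elim by (simp add: Ihat_def)
          then show ?thesis by (auto simp: Iint_def)
        qed
        ultimately show ?case using N[of x t] t by (simp add: G_def Jint_def less_imp_le)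
      qed
    qed (use i\<Phi> iG in auto)
    finally show ?thesis by (simp add: prob_space)
  qed
  have "(\<lambda>i. LINT y|mu (ts i). G y (ts i)) \<longlonglongrightarrow> (LINT y|mu t0. G y t0)"
    by (rule is_acim_weakly_continuous[OF mu G _ ts t0 lim, of B]) (auto simp: G_def B)
  from LIMSEQ_D[OF this, of "e / 3"] e obtain n0 where
    n0: "\<And>i. i \<ge> n0 \<Longrightarrow> \<bar>(LINT y|mu (ts i). G y (ts i)) - (LINT y|mu t0. G y t0)\<bar> < e / 3" by auto
  have "norm ((LINT x|hmu (ts i). \<Phi> (x, ts i)) - (LINT x|hmu t0. \<Phi> (x, t0))) < e" if "i \<ge> n0" for i
    using est[OF ts[of i]] est[OF t0] n0[OF that] unfolding real_norm_def by linarith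
  then show "\<exists>n0. \<forall>i\<ge>n0. norm ((LINT x|hmu (ts i). \<Phi> (x, ts i)) - (LINT x|hmu t0. \<Phi> (x, t0))) < e"
    by blast
qed

theorem mainTheorem4:
  fixes P :: "real \<Rightarrow> real \<Rightarrow> complex"
    and fbar :: "real \<Rightarrow> complex \<Rightarrow> complex"
    and h :: "real \<Rightarrow> (nat \<Rightarrow> complex) \<Rightarrow> complex"
    and mu :: "real \<Rightarrow> real measure"
    and hmu :: "real \<Rightarrow> (nat \<Rightarrow> complex) measure"
    and ts :: "nat \<Rightarrow> real" and t0 :: real
    and \<alpha> :: "complex \<Rightarrow> real"
  assumes coords: "disk_coords P"
    and unwr: "unwrapping P fbar"
    and h_cont: "continuous_on {(x, t). t \<in> Jint \<and> x \<in> Dhat P fbar t} (\<lambda>(x, t). h t x)"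
    and h_homeo: "\<forall>t\<in>Jint. \<exists>g. homeomorphism (Dhat P fbar t) (cball 0 1) (h t) g"
    and mu_acim: "\<forall>t\<in>Jint. is_acim t (mu t)"
    and hmu_ind: "\<forall>t\<in>Jint. is_induced_measure t (mu t) (hmu t)"
    and ts_J: "\<forall>i. ts i \<in> Jint" and t0_J: "t0 \<in> Jint"
    and ts_lim: "ts \<longlonglongrightarrow> t0"
    and \<alpha>_cont: "continuous_on (cball 0 1) \<alpha>"
  shows "(\<lambda>i. integral\<^sup>L (nu_meas P fbar h hmu (ts i)) \<alpha>)
           \<longlonglongrightarrow> integral\<^sup>L (nu_meas P fbar h hmu t0) \<alpha>"
proof -
  define \<tau> where "\<tau> = (1 + t0) / 2"
  have \<tau>: "1 < \<tau>" "\<tau> < t0" using t0_J by (auto simp: \<tau>_def Jint_def)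
  \<comment> \<open>\<open>Jint\<close> is open at 1; restricting t to \<open>{\<tau>..2}\<close>
    keeps the graph closed.\<close>
  define C where "C = {(x, t). t \<in> {\<tau>..2} \<and> x \<in> Ihat t}"
  have CD: "C \<subseteq> {(x, t). t \<in> Jint \<and> x \<in> Dhat P fbar t}"
  proof (unfold C_def, clarify)
    fix x t assume "t \<in> {\<tau>..2}" and x: "x \<in> Ihat t"
    then have t: "t \<in> Jint" using \<tau> by (auto simp: Jint_def)
    with Ihat_subset_Dhat[OF unwr t] x show "t \<in> Jint \<and> x \<in> Dhat P fbar t" by blast
  qed
  have h_disk: "h t x \<in> cball 0 1" if "t \<in> Jint" "x \<in> Dhat P fbar t" for t x
    using h_homeo that homeomorphism_image1 by blast
  have "bounded (\<alpha> ` cball 0 1)"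
    by (intro compact_imp_bounded compact_continuous_image \<alpha>_cont) auto
  then obtain B where B: "\<And>z. z \<in> cball 0 1 \<Longrightarrow> norm (\<alpha> z) \<le> B"
    unfolding bounded_iff by (meson imageI)
  have "norm (\<alpha> 0) \<le> B" by (rule B) simp
  then have "0 \<le> B" by (rule order_trans[OF norm_ge_zero])
  have cont: "continuous_on C (\<lambda>z. \<alpha> ((\<lambda>(x, t). h t x) z))"
    by (rule continuous_on_compose2[OF \<alpha>_cont continuous_on_subset[OF h_cont CD]])
       (use CD h_disk in auto)
  have closed: "closedin (top_of_set UNIV) C"
    using closed_Ihat_graph by (simp add: C_def)
  have bound: "norm (\<alpha> ((\<lambda>(x, t). h t x) z)) \<le> B" if "z \<in> C" for z
    by (rule B) (use that CD h_disk in auto)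
  \<comment> \<open>Tietze extends \<open>\<alpha>\<close> composed with h from C, jointly in x and
    t, to one bounded continuous function on the whole product.\<close>
  obtain \<Phi> where \<Phi>: "continuous_on UNIV \<Phi>"
    "\<And>z. z \<in> C \<Longrightarrow> \<Phi> z = \<alpha> ((\<lambda>(x, t). h t x) z)" "\<And>z. z \<in> UNIV \<Longrightarrow> norm (\<Phi> z) \<le> B"
    by (rule Tietze[OF cont closed \<open>0 \<le> B\<close> bound]) (assumption | rule that)+
  have nu: "(LINT z|nu_meas P fbar h hmu t. \<alpha> z) = (LINT x|hmu t. \<Phi> (x, t))"
    if t: "t \<in> Jint" "\<tau> \<le> t" for t
  proof -
    obtain g where g: "homeomorphism (Dhat P fbar t) (cball 0 1) (h t) g" using h_homeo t by blast
    show ?thesis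
    proof (rule nu_meas_integral[where h = h and mu = mu and g = g])
      show "unwrapping P fbar" "t \<in> Jint" "homeomorphism (Dhat P fbar t) (cball 0 1) (h t) g"
        "continuous_on (cball 0 1) \<alpha>" by (fact unwr t(1) g \<alpha>_cont)+
      show "is_induced_measure t (mu t) (hmu t)" using hmu_ind t by blast
      show "continuous_on UNIV (\<lambda>x. \<Phi> (x, t))"
        by (rule continuous_on_compose2[OF \<Phi>(1)]) (auto intro!: continuous_intros)
      show "\<Phi> (x, t) = \<alpha> (h t x)" if "x \<in> Ihat t" for x
        using \<Phi>(2)[of "(x, t)"] that t by (simp add: C_def Jint_def)
    qed
  qed
  have "(\<lambda>i. LINT x|hmu (ts i). \<Phi> (x, ts i)) \<longlonglongrightarrow> (LINT x|hmu t0. \<Phi> (x, t0))"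
    using mu_acim hmu_ind ts_J t0_J ts_lim \<Phi>
    by (intro induced_measures_weakly_continuous[where mu = mu and B = B]) auto
  \<comment> \<open>The extension represents the test function only for
    \<open>t \<ge> \<tau>\<close>, which holds for all large i.\<close>
  moreover have "\<forall>\<^sub>F i in sequentially.
      (LINT x|hmu (ts i). \<Phi> (x, ts i)) = integral\<^sup>L (nu_meas P fbar h hmu (ts i)) \<alpha>"
    using order_tendstoD(1)[OF ts_lim \<tau>(2)] by eventually_elim (use nu ts_J in auto)
  ultimately have "(\<lambda>i. integral\<^sup>L (nu_meas P fbar h hmu (ts i)) \<alpha>) \<longlonglongrightarrow> (LINT x|hmu t0. \<Phi> (x, t0))"
    by (rule Lim_transform_eventually)
  then show ?thesis using nu[OF t0_J less_imp_le[OF \<tau>(2)]] by simp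
qed

end
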